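(* Let $G$ be a finite group and let $m$ be a positive integer. Suppose that for every proper normal subgroup $H$ of $G$, the quotient $G/H$ is non-Abelian and has order at least $m$. Then $G$ has no non-trivial representation of dimension less than $\sqrt{\log m}/2$. Conversely, if $G$ has a non-trivial Abelian quotient, then $G$ has a non-trivial $1$-dimensional representation, and if $G$ has a non-trivial quotient of order $m$, then $G$ has a non-trivial representation of dimension at most $\sqrt m$.
   Context: Representations are finite-dimensional complex representations. A representation is non-trivial if at least one group element acts as something other than the identity map. A quotient $G/H$ is non-trivial if $H\neq G$. Here $\log$ is the natural logarithm, and $\sqrt{\log m}/2$ means $\frac12\sqrt{\log m}$. *)

theory Defs
  imports
    Complex_Main
    "HOL-Algebra.Coset"
    "Jordan_Normal_Form.Matrix"
begin

text \<open>
  A representation of dimension \<open>d\<close> is a homomorphism into \<open>GL\<^sub>d(\<complex>)\<close>, that is, a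
  representation on \<open>\<complex>\<^sup>d\<close> with its standard basis. The dimension \<open>d\<close> is an ordinary natural
  number, so one can quantify over it.
\<close>

definition complex_GL :: "nat \<Rightarrow> complex mat monoid" where
  "complex_GL d = units_of (ring_mat TYPE(complex) d ())"

definition is_representation ::
  "('a, 'b) monoid_scheme \<Rightarrow> nat \<Rightarrow> ('a \<Rightarrow> complex mat) \<Rightarrow> bool" where
  "is_representation G d \<rho> \<longleftrightarrow> \<rho> \<in> hom G (complex_GL d)"

definition nontrivial_representation ::
  "('a, 'b) monoid_scheme \<Rightarrow> nat \<Rightarrow> ('a \<Rightarrow> complex mat) \<Rightarrow> bool" where
  "nontrivial_representation G d \<rho> \<longleftrightarrow>
     is_representation G d \<rho> \<and> (\<exists>g\<in>carrier G. \<rho> g \<noteq> 1\<^sub>m d)"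

lemma group_complex_GL: "group (complex_GL d)"
proof -
  interpret ring "ring_mat TYPE(complex) d ()"
    by (rule ring_mat)
  show ?thesis
    unfolding complex_GL_def by (rule units_group)
qed

lemma one_complex_GL: "\<one>\<^bsub>complex_GL d\<^esub> = 1\<^sub>m d"
  by (simp add: complex_GL_def units_of_def ring_mat_simps)

lemma mult_complex_GL: "A \<otimes>\<^bsub>complex_GL d\<^esub> B = A * B"
  by (simp add: complex_GL_def units_of_def ring_mat_simps)

lemma carrier_complex_GL:
  "carrier (complex_GL d) =
     {A \<in> carrier_mat d d. \<exists>B\<in>carrier_mat d d. B * A = 1\<^sub>m d \<and> A * B = 1\<^sub>m d}"
  by (simp add: complex_GL_def units_of_def Units_def ring_mat_simps)

end

theory Submission
  imports "Jordan_Normal_Form.Spectral_Radius" "HOL-Algebra.Generated_Groups" Defs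
begin

text \<open>
  Lower bound: let \<open>\<rho>\<close> be a non-trivial representation of dimension \<open>d\<close>, choose a submultiplicative
  norm \<open>N\<close> on matrices with \<open>N (\<rho> g) \<le> 1\<close> for all \<open>g\<close>, and put \<open>\<delta> g = N (\<rho> g - 1)\<close>. The elements
  with \<open>\<delta> g < 1/2\<close> generate a normal subgroup \<open>H\<close>. Representatives of distinct cosets of \<open>H\<close> are
  mapped to points of the unit ball at distance at least \<open>1/2\<close>, and a real space of dimension
  \<open>2d\<^sup>2\<close> contains at most \<open>6\<close> to the power \<open>2d\<^sup>2\<close> such points. This is less than \<open>m\<close>, so
  \<open>H = G\<close>. Commutators satisfy \<open>\<delta> [g, h] \<le> 2 \<delta> g \<delta> h\<close>; so if \<open>M\<close> is a maximal proper
  normal subgroup containing the kernel and \<open>g\<close> minimises \<open>\<delta>\<close> among the generators outside \<open>M\<close>,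
  then \<open>g\<close> commutes modulo \<open>M\<close> with every generator. Hence \<open>G/M\<close> has non-trivial centre, and is
  Abelian by maximality of \<open>M\<close>.

  Upper bounds: in a non-trivial representation of minimal dimension \<open>d\<close> of a finite group \<open>Q\<close>,
  every matrix commuting with the action is scalar. So \<open>d = 1\<close> if \<open>Q\<close> is Abelian, and in general
  Schur orthogonality makes the \<open>d\<^sup>2\<close> matrix coefficients linearly independent functions
  on \<open>Q\<close>, whence \<open>d\<^sup>2 \<le> |Q|\<close>.
\<close>

section \<open>Separated sets in finite-dimensional normed spaces\<close>

text \<open>If \<open>n > b\<close>, the powers of \<open>n / b\<close> outgrow every fixed
  \<open>A\<close>. In this way a multiplicative loss that does not depend on \<open>J\<close>
  disappears from a bound on \<open>J\<close>-fold iterates.\<close>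

lemma le_of_power_le_const_mult:
  fixes n b A :: nat
  assumes b: "b > 0" and le: "\<And>J. n ^ J \<le> A * b ^ J"
  shows "n \<le> b"
proof (rule ccontr)
  assume "\<not> n \<le> b"
  then have "1 < real n / real b" using b by simp
  then obtain J where J: "real A < (real n / real b) ^ J"
    using real_arch_pow by blast
  then have "real A * real b ^ J < real n ^ J"
    using b by (simp add: power_divide pos_less_divide_eq)
  then have "A * b ^ J < n ^ J"
    by (metis of_nat_less_iff of_nat_mult of_nat_power)
  then show False using le[of J] by simp
qed

text \<open>A self-similar iteration takes the place of the usual comparison of volumes of disjoint
  balls. \<open>bound\<close> enters only in the crude counting at the end, so the value of
  \<open>C\<close> leaves no trace in the conclusion.\<close>

lemma separated_set_card_bound:
  fixes N :: "('i \<Rightarrow> real) \<Rightarrow> real" and P :: "('i \<Rightarrow> real) set"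
  assumes I: "finite I" and P: "finite P"
    and tri: "\<And>x y. N (\<lambda>i. x i + y i) \<le> N x + N y"
    and scale: "\<And>c x. N (\<lambda>i. c * x i) = \<bar>c\<bar> * N x"
    and bound: "\<And>x. N x \<le> C * (\<Sum>i\<in>I. \<bar>x i\<bar>)"
    and diam: "\<And>x y. x \<in> P \<Longrightarrow> y \<in> P \<Longrightarrow> N (\<lambda>i. x i - y i) \<le> 2"
    and sep: "\<And>x y. x \<in> P \<Longrightarrow> y \<in> P \<Longrightarrow> x \<noteq> y \<Longrightarrow> 1 / 2 \<le> N (\<lambda>i. x i - y i)"
  shows "card P \<le> 6 ^ card I"
proof -
  define R where "R = 1 + (\<Sum>p\<in>P. \<Sum>i\<in>I. \<bar>p i\<bar>)"
  have R: "\<bar>p i\<bar> \<le> R" if "p \<in> P" "i \<in> I" for p i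
  proof -
    have "\<bar>p i\<bar> \<le> (\<Sum>i\<in>I. \<bar>p i\<bar>)" using that I by (intro member_le_sum) auto
    also have "\<dots> \<le> (\<Sum>p\<in>P. \<Sum>i\<in>I. \<bar>p i\<bar>)"
      using that P by (intro member_le_sum[of p P "\<lambda>p. \<Sum>i\<in>I. \<bar>p i\<bar>"]) (auto simp: sum_nonneg)
    finally show ?thesis unfolding R_def by simp
  qed
  have R0: "R > 0" unfolding R_def by (intro add_pos_nonneg sum_nonneg) auto
  \<comment> \<open>With \<open>\<bar>q i\<bar> \<le> 2 * R\<close> and the grid scale
    \<open>e\<close> chosen below, this yields \<open>\<bar>e * q i\<bar> \<le> K * 6 ^ J\<close>;
    hence \<open>20 = 10 * 2\<close>. The maximum keeps the factor positive for any
    \<open>C\<close>.\<close>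
  define K :: nat where "K = nat \<lceil>20 * R * max C 1 * (card I + 1)\<rceil> + 1"
  have K: "20 * R * max C 1 * (card I + 1) \<le> K"
    unfolding K_def by linarith
  have K1: "K \<ge> 1" unfolding K_def by simp
  text \<open>Replacing \<open>Q\<close> by \<open>P + Q / 6\<close> multiplies the number of points by \<open>card P\<close> while the
    separation decreases only by the factor 6; the crude grid bound on \<open>n\<close>-fold iterates then
    yields the constant 6.\<close>
  define good where "good J Q \<longleftrightarrow> finite Q \<and> card Q = card P ^ J \<and> (\<forall>q\<in>Q. \<forall>i\<in>I. \<bar>q i\<bar> \<le> 2 * R) \<and>
      (\<forall>p\<in>Q. \<forall>q\<in>Q. N (\<lambda>i. p i - q i) \<le> 12 / 5) \<and>
      (\<forall>p\<in>Q. \<forall>q\<in>Q. p \<noteq> q \<longrightarrow> 1 / (10 * 6 ^ J) \<le> N (\<lambda>i. p i - q i))" for J Q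
  have iter: "\<exists>Q. good J Q" for J
  proof (induction J)
    case 0
    have "N (\<lambda>i. 0) = 0" using scale[of 0 "\<lambda>i. 0"] by simp
    then show ?case using R0 by (intro exI[of _ "{\<lambda>i. 0}"]) (simp add: good_def)
  next
    case (Suc J)
    then obtain Q where "good J Q" by blast
    then have Q: "finite Q" "card Q = card P ^ J" "\<And>q i. q \<in> Q \<Longrightarrow> i \<in> I \<Longrightarrow> \<bar>q i\<bar> \<le> 2 * R"
      "\<And>p q. p \<in> Q \<Longrightarrow> q \<in> Q \<Longrightarrow> N (\<lambda>i. p i - q i) \<le> 12 / 5"
      "\<And>p q. p \<in> Q \<Longrightarrow> q \<in> Q \<Longrightarrow> p \<noteq> q \<Longrightarrow> 1 / (10 * 6 ^ J) \<le> N (\<lambda>i. p i - q i)"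
      unfolding good_def by blast+
    define f where "f = (\<lambda>(p :: 'i \<Rightarrow> real, q :: 'i \<Rightarrow> real) i. p i + q i / 6)"
    have diff: "(\<lambda>i. f (p, q) i - f (p', q') i) = (\<lambda>i. (p i - p' i) + (1 / 6) * (q i - q' i))" for p q p' q'
      by (auto simp: f_def field_simps)
    have up: "N (\<lambda>i. f (p, q) i - f (p', q') i) \<le> N (\<lambda>i. p i - p' i) + N (\<lambda>i. q i - q' i) / 6" for p q p' q'
      unfolding diff using tri[of "\<lambda>i. p i - p' i" "\<lambda>i. (1 / 6) * (q i - q' i)"]
        scale[of "1 / 6" "\<lambda>i. q i - q' i"] by simp
    have low: "N (\<lambda>i. p i - p' i) - N (\<lambda>i. q i - q' i) / 6 \<le> N (\<lambda>i. f (p, q) i - f (p', q') i)" for p q p' q'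
    proof -
      have "N (\<lambda>i. p i - p' i) = N (\<lambda>i. ((p i - p' i) + (1 / 6) * (q i - q' i)) + (- 1 / 6) * (q i - q' i))"
        by simp
      also have "\<dots> \<le> N (\<lambda>i. f (p, q) i - f (p', q') i) + N (\<lambda>i. (- 1 / 6) * (q i - q' i))"
        unfolding diff by (rule tri)
      also have "N (\<lambda>i. (- 1 / 6) * (q i - q' i)) = N (\<lambda>i. q i - q' i) / 6"
        using scale[of "- 1 / 6" "\<lambda>i. q i - q' i"] by simp
      finally show ?thesis by simp
    qed
    \<comment> \<open>Equal \<open>P\<close>-components leave the separation of \<open>Q\<close>
      divided by 6. Distinct ones give at least \<open>1 / 2 - (12 / 5) / 6 = 1 / 10\<close>, which
      is the constant in \<open>good\<close>.\<close>
    have sepf: "1 / (10 * 6 ^ Suc J) \<le> N (\<lambda>i. f (p, q) i - f (p', q') i)"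
      if "p \<in> P" "p' \<in> P" "q \<in> Q" "q' \<in> Q" "(p, q) \<noteq> (p', q')" for p q p' q'
    proof (cases "p = p'")
      case True
      with that have "q \<noteq> q'" by auto
      have "N (\<lambda>i. f (p, q) i - f (p', q') i) = N (\<lambda>i. q i - q' i) / 6"
        unfolding diff using scale[of "1 / 6" "\<lambda>i. q i - q' i"] True by simp
      moreover have "1 / (10 * 6 ^ Suc J) = 1 / (10 * 6 ^ J) / (6 :: real)" by simp
      moreover have "1 / (10 * 6 ^ J) / (6 :: real) \<le> N (\<lambda>i. q i - q' i) / 6"
        by (intro divide_right_mono Q(5)[OF that(3,4) \<open>q \<noteq> q'\<close>]) simp
      ultimately show ?thesis by simp
    next
      case False
      have "1 / (10 * 6 ^ Suc J) \<le> (1 :: real) / 10"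
        using one_le_power[of "6 :: real" "Suc J"] by (simp add: field_simps)
      also have "\<dots> \<le> N (\<lambda>i. p i - p' i) - N (\<lambda>i. q i - q' i) / 6"
        using sep[OF that(1,2) False] Q(4)[OF that(3,4)] by simp
      finally show ?thesis using low[of p p' q q'] by linarith
    qed
    have N0: "N (\<lambda>i. 0) = 0" using scale[of 0 "\<lambda>i. 0"] by simp
    have inj: "inj_on f (P \<times> Q)"
    proof (intro inj_onI, clarify)
      fix p q p' q' assume h: "p \<in> P" "q \<in> Q" "p' \<in> P" "q' \<in> Q" "f (p, q) = f (p', q')"
      show "p = p' \<and> q = q'"
      proof (rule ccontr)
        assume "\<not> ?thesis"
        then have "1 / (10 * 6 ^ Suc J) \<le> N (\<lambda>i. f (p, q) i - f (p', q') i)"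
          using sepf[OF h(1,3,2,4)] by auto
        then have "1 / (10 * 6 ^ Suc J) \<le> (0 :: real)" using h(5) N0 by simp
        moreover have "0 < 1 / (10 * 6 ^ Suc J :: real)" by simp
        ultimately show False by linarith
      qed
    qed
    have "good (Suc J) (f ` (P \<times> Q))"
      unfolding good_def
    proof (intro conjI)
      show "card (f ` (P \<times> Q)) = card P ^ Suc J"
        using card_image[OF inj] Q(2) by (simp add: card_cartesian_product)
      show "\<forall>q\<in>f ` (P \<times> Q). \<forall>i\<in>I. \<bar>q i\<bar> \<le> 2 * R"
      proof clarify
        fix p q i assume h: "p \<in> P" "q \<in> Q" "i \<in> I"
        show "\<bar>f (p, q) i\<bar> \<le> 2 * R"
          using R[OF h(1,3)] Q(3)[OF h(2,3)] R0 by (auto simp: f_def)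
      qed
      \<comment> \<open>\<open>12 / 5\<close> solves \<open>D = 2 + D / 6\<close>, so the step
        reproduces this diameter bound.\<close>
      show "\<forall>p\<in>f ` (P \<times> Q). \<forall>q\<in>f ` (P \<times> Q). N (\<lambda>i. p i - q i) \<le> 12 / 5"
      proof clarify
        fix p q p' q' assume h: "p \<in> P" "q \<in> Q" "p' \<in> P" "q' \<in> Q"
        show "N (\<lambda>i. f (p, q) i - f (p', q') i) \<le> 12 / 5"
          using up[of p q p' q'] diam[OF h(1,3)] Q(4)[OF h(2,4)] by simp
      qed
      show "\<forall>p\<in>f ` (P \<times> Q). \<forall>q\<in>f ` (P \<times> Q). p \<noteq> q \<longrightarrow> 1 / (10 * 6 ^ Suc J) \<le> N (\<lambda>i. p i - q i)"
        using sepf by fastforce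
    qed (use P Q(1) in simp)
    then show ?case ..
  qed
  have "card P ^ J \<le> (3 * K) ^ card I * (6 ^ card I) ^ J" for J
  proof -
    obtain Q where "good J Q" using iter by blast
    then have Q: "finite Q" "card Q = card P ^ J" "\<And>q i. q \<in> Q \<Longrightarrow> i \<in> I \<Longrightarrow> \<bar>q i\<bar> \<le> 2 * R"
      "\<And>p q. p \<in> Q \<Longrightarrow> q \<in> Q \<Longrightarrow> p \<noteq> q \<Longrightarrow> 1 / (10 * 6 ^ J) \<le> N (\<lambda>i. p i - q i)"
      unfolding good_def by blast+
    \<comment> \<open>Two points of one grid cell of side \<open>1 / e\<close> are at
      \<open>N\<close>-distance at most \<open>max C 1 * card I / e\<close>, which is less than
      \<open>1 / (10 * 6 ^ J)\<close> because of \<open>card I + 1\<close>. So a cell contains at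
      most one point of \<open>Q\<close>.\<close>
    define e where "e = 10 * 6 ^ J * max C 1 * (card I + 1)"
    have e: "e > 0" unfolding e_def by (intro mult_pos_pos) auto
    define T :: int where "T = K * 6 ^ J"
    have T1: "T \<ge> 1" unfolding T_def using K1
      by (metis mult_is_0 not_one_le_zero of_nat_0_less_iff of_nat_mult of_nat_numeral of_nat_power power_not_zero zero_neq_numeral int_one_le_iff_zero_less gr0I)
    define \<phi> where "\<phi> = (\<lambda>q. \<lambda>i\<in>I. \<lfloor>e * q i\<rfloor>)"
    have maps: "\<phi> ` Q \<subseteq> PiE I (\<lambda>_. {- T..T})"
    proof
      fix y assume "y \<in> \<phi> ` Q"
      then obtain q where q: "q \<in> Q" "y = \<phi> q" by auto
      have "\<lfloor>e * q i\<rfloor> \<in> {- T..T}" if "i \<in> I" for i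
      proof -
        have "\<bar>e * q i\<bar> \<le> e * (2 * R)" using Q(3)[OF q(1) that] e by (simp add: abs_mult)
        also have "\<dots> = 6 ^ J * (20 * R * max C 1 * (card I + 1))" by (simp add: e_def)
        also have "\<dots> \<le> 6 ^ J * real K" using K by (intro mult_left_mono) auto
        also have "\<dots> = real_of_int T" by (simp add: T_def)
        finally show ?thesis by (auto simp: abs_le_iff le_floor_iff floor_le_iff)
      qed
      then show "y \<in> PiE I (\<lambda>_. {- T..T})" using q by (auto simp: \<phi>_def)
    qed
    have inj: "inj_on \<phi> Q"
    proof (rule inj_onI, rule ccontr)
      fix p q assume h: "p \<in> Q" "q \<in> Q" "\<phi> p = \<phi> q" "p \<noteq> q"
      have "e * \<bar>p i - q i\<bar> \<le> 1" if "i \<in> I" for i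
      proof -
        have "\<lfloor>e * p i\<rfloor> = \<lfloor>e * q i\<rfloor>" using fun_cong[OF h(3), of i] that by (simp add: \<phi>_def)
        then have "\<bar>e * p i - e * q i\<bar> \<le> 1" by linarith
        then show ?thesis using e by (simp add: abs_mult flip: right_diff_distrib)
      qed
      then have "(\<Sum>i\<in>I. e * \<bar>p i - q i\<bar>) \<le> card I" using sum_bounded_above[of I "\<lambda>i. e * \<bar>p i - q i\<bar>" 1] by simp
      then have s: "e * (\<Sum>i\<in>I. \<bar>p i - q i\<bar>) \<le> card I" by (simp add: sum_distrib_left)
      have "1 / (10 * 6 ^ J) \<le> N (\<lambda>i. p i - q i)" by (rule Q(4)[OF h(1,2,4)])
      also have "\<dots> \<le> max C 1 * (\<Sum>i\<in>I. \<bar>p i - q i\<bar>)"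
        using bound[of "\<lambda>i. p i - q i"] mult_right_mono[of C "max C 1" "\<Sum>i\<in>I. \<bar>p i - q i\<bar>"]
        by (force simp: sum_nonneg)
      finally have "1 \<le> 10 * 6 ^ J * (max C 1 * (\<Sum>i\<in>I. \<bar>p i - q i\<bar>))"
        by (simp add: field_simps)
      then have "real (card I + 1) * 1 \<le> (card I + 1) * (10 * 6 ^ J * (max C 1 * (\<Sum>i\<in>I. \<bar>p i - q i\<bar>)))"
        by (intro mult_left_mono) auto
      also have "\<dots> = e * (\<Sum>i\<in>I. \<bar>p i - q i\<bar>)" by (simp add: e_def)
      finally show False using s by simp
    qed
    \<comment> \<open>The number of cells depends on \<open>J\<close> only through
      \<open>(6 ^ card I) ^ J\<close>; the other factor is constant and is removed by
      \<open>le_of_power_le_const_mult\<close>.\<close>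
    have "card P ^ J = card (\<phi> ` Q)" using Q(2) card_image[OF inj] by simp
    also have "\<dots> \<le> card (PiE I (\<lambda>_. {- T..T}))" using I by (intro card_mono maps finite_PiE) auto
    also have "\<dots> = nat (2 * T + 1) ^ card I" using I by (simp add: card_PiE)
    also have "\<dots> \<le> nat (3 * T) ^ card I" using T1 by (intro power_mono) auto
    also have "nat (3 * T) = 3 * K * 6 ^ J" unfolding T_def by (simp add: nat_mult_distrib nat_power_eq)
    also have "(3 * K * 6 ^ J) ^ card I = (3 * K) ^ card I * (6 ^ card I) ^ J"
      by (simp add: power_mult_distrib power_mult[symmetric] mult.commute)
    finally show ?thesis .
  qed
  then show ?thesis by (rule le_of_power_le_const_mult[rotated]) simp
qed

section \<open>Representations of minimal dimension\<close>

text \<open>Gaussian elimination: an equation with a coefficient \<open>a k l \<noteq> 0\<close> is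
  solved for \<open>c l\<close> and substituted into the others. This removes one equation and one
  unknown and keeps the surplus of unknowns.\<close>

lemma nontrivial_solution_exists:
  fixes a :: "'i \<Rightarrow> 'j \<Rightarrow> 'k :: field"
  assumes "finite I" "finite J" "card I < card J"
  shows "\<exists>c. (\<exists>j\<in>J. c j \<noteq> 0) \<and> (\<forall>i\<in>I. (\<Sum>j\<in>J. a i j * c j) = 0)"
  using assms
proof (induction I arbitrary: J a rule: finite_induct)
  case empty
  then have "J \<noteq> {}" by auto
  then show ?case by (intro exI[of _ "\<lambda>_. 1"]) auto
next
  case (insert k I)
  show ?case
  proof (cases "\<forall>j\<in>J. a k j = 0")
    case True
    have "card I < card J" using insert by simp
    then obtain c where "\<exists>j\<in>J. c j \<noteq> 0" "\<forall>i\<in>I. (\<Sum>j\<in>J. a i j * c j) = 0"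
      using insert.IH[OF \<open>finite J\<close>, of a] by blast
    then show ?thesis using True by (intro exI[of _ c]) auto
  next
    case False
    then obtain l where l: "l \<in> J" "a k l \<noteq> 0" by auto
    have "card I < card (J - {l})" using insert l by simp
    then obtain c where c: "\<exists>j\<in>J - {l}. c j \<noteq> 0"
      "\<forall>i\<in>I. (\<Sum>j\<in>J - {l}. (a i j - a i l * a k j / a k l) * c j) = 0"
      using insert.IH[of "J - {l}" "\<lambda>i j. a i j - a i l * a k j / a k l"] insert.prems by auto
    define s where "s = (\<Sum>j\<in>J - {l}. a k j * c j)"
    define c' where "c' = c(l := - s / a k l)"
    have split: "(\<Sum>j\<in>J. a i j * c' j) = (\<Sum>j\<in>J - {l}. a i j * c j) - a i l * s / a k l" for i
      using insert.prems(1) l(1) by (simp add: sum.remove c'_def)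
    have "(\<Sum>j\<in>J. a i j * c' j) = 0" if "i \<in> I" for i
      using c(2) that unfolding split s_def
      by (simp add: left_diff_distrib sum_subtractf sum_distrib_left sum_divide_distrib mult.assoc)
    moreover have "(\<Sum>j\<in>J. a k j * c' j) = 0" unfolding split using l by (simp add: s_def)
    moreover have "\<exists>j\<in>J. c' j \<noteq> 0" using c(1) by (auto simp: c'_def)
    ultimately show ?thesis by (intro exI[of _ c']) auto
  qed
qed

section \<open>Representations in matrix form, inflation, the regular representation\<close>

text \<open>From right to left, the image of the inverse element serves as the inverse matrix. Later
  arguments can then work with plain matrix identities.\<close>

lemma is_representation_iff:
  assumes "group G"
  shows "is_representation G d \<rho> \<longleftrightarrow> (\<forall>g\<in>carrier G. \<rho> g \<in> carrier_mat d d) \<and>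
    (\<forall>g\<in>carrier G. \<forall>h\<in>carrier G. \<rho> (g \<otimes>\<^bsub>G\<^esub> h) = \<rho> g * \<rho> h) \<and> \<rho> \<one>\<^bsub>G\<^esub> = 1\<^sub>m d"
    (is "?l \<longleftrightarrow> ?r")
proof
  interpret group G by fact
  assume ?l
  then have h: "\<rho> \<in> hom G (complex_GL d)" unfolding is_representation_def .
  interpret group_hom G "complex_GL d" \<rho>
    using h group_complex_GL assms by (intro group_hom.intro) (auto simp: group_hom_axioms_def)
  show ?r using h hom_one by (auto simp: hom_def carrier_complex_GL mult_complex_GL one_complex_GL)
next
  interpret group G by fact
  assume r: ?r
  have mult: "\<rho> (g \<otimes>\<^bsub>G\<^esub> h) = \<rho> g * \<rho> h" if "g \<in> carrier G" "h \<in> carrier G" for g h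
    using r that by blast
  have "\<rho> g \<in> carrier (complex_GL d)" if g: "g \<in> carrier G" for g
  proof -
    have "\<rho> (inv\<^bsub>G\<^esub> g) * \<rho> g = 1\<^sub>m d" "\<rho> g * \<rho> (inv\<^bsub>G\<^esub> g) = 1\<^sub>m d"
      using mult[of "inv\<^bsub>G\<^esub> g" g] mult[of g "inv\<^bsub>G\<^esub> g"] g r by simp_all
    moreover have "\<rho> g \<in> carrier_mat d d" "\<rho> (inv\<^bsub>G\<^esub> g) \<in> carrier_mat d d" using r g by simp_all
    ultimately show ?thesis unfolding carrier_complex_GL by blast
  qed
  then show ?l using r unfolding is_representation_def by (auto simp: hom_def mult_complex_GL)
qed

lemma nontrivial_representation_dim_pos:
  assumes "group G" "nontrivial_representation G d \<rho>"
  shows "d > 0"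
proof (rule ccontr)
  assume "\<not> d > 0"
  moreover obtain g where "g \<in> carrier G" "\<rho> g \<noteq> 1\<^sub>m d" "\<rho> g \<in> carrier_mat d d"
    using assms is_representation_iff unfolding nontrivial_representation_def by blast
  moreover from calculation have "\<rho> g = 1\<^sub>m d" by (intro eq_matI) auto
  ultimately show False by simp
qed

lemma nontrivial_representation_inflate:
  assumes "H \<lhd> G" "nontrivial_representation (G Mod H) d \<rho>"
  shows "nontrivial_representation G d (\<lambda>g. \<rho> (H #>\<^bsub>G\<^esub> g))"
proof -
  interpret normal H G by fact
  have \<rho>: "\<rho> \<in> hom (G Mod H) (complex_GL d)"
    using assms(2) unfolding nontrivial_representation_def is_representation_def by simp
  have "(\<lambda>g. \<rho> (H #>\<^bsub>G\<^esub> g)) \<in> hom G (complex_GL d)"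
  proof (rule homI)
    fix g h assume g: "g \<in> carrier G" and h: "h \<in> carrier G"
    then show "\<rho> (H #>\<^bsub>G\<^esub> g) \<in> carrier (complex_GL d)"
      using hom_in_carrier[OF r_coset_hom_Mod] hom_in_carrier[OF \<rho>] by blast
    show "\<rho> (H #>\<^bsub>G\<^esub> (g \<otimes>\<^bsub>G\<^esub> h)) = \<rho> (H #>\<^bsub>G\<^esub> g) \<otimes>\<^bsub>complex_GL d\<^esub> \<rho> (H #>\<^bsub>G\<^esub> h)"
      unfolding hom_mult[OF r_coset_hom_Mod g h]
      by (rule hom_mult[OF \<rho> hom_in_carrier[OF r_coset_hom_Mod g] hom_in_carrier[OF r_coset_hom_Mod h]])
  qed
  moreover obtain g where "g \<in> carrier G" "\<rho> (H #>\<^bsub>G\<^esub> g) \<noteq> 1\<^sub>m d"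
    using assms(2) unfolding nontrivial_representation_def by (auto simp: FactGroup_def RCOSETS_def)
  ultimately show ?thesis
    unfolding nontrivial_representation_def is_representation_def by blast
qed

text \<open>Left multiplication permutes the group; \<open>\<rho> g\<close> is its permutation
  matrix in the enumeration \<open>e\<close>. This guarantees that a least dimension of non-trivial
  representations exists.\<close>

lemma regular_representation_nontrivial:
  assumes G: "group G" and fin: "finite (carrier G)" and nt: "order G \<noteq> 1"
  shows "\<exists>\<rho>. nontrivial_representation G (order G) \<rho>"
proof -
  interpret group G by fact
  let ?n = "order G"
  obtain e where e: "bij_betw e {..<?n} (carrier G)"
    using ex_bij_betw_nat_finite[OF fin] by (auto simp: order_def atLeast0LessThan)
  have ec: "e i \<in> carrier G" if "i < ?n" for i using bij_betwE[OF e] that by auto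
  define \<rho> where "\<rho> g = mat ?n ?n (\<lambda>(i, j). if e i = g \<otimes>\<^bsub>G\<^esub> e j then 1 else 0 :: complex)" for g
  have mult: "\<rho> (g \<otimes>\<^bsub>G\<^esub> h) = \<rho> g * \<rho> h" if gh: "g \<in> carrier G" "h \<in> carrier G" for g h
  proof (rule eq_matI)
    fix i l assume "i < dim_row (\<rho> g * \<rho> h)" "l < dim_col (\<rho> g * \<rho> h)"
    then have il: "i < ?n" "l < ?n" by (auto simp: \<rho>_def)
    have "(\<rho> g * \<rho> h) $$ (i, l)
        = (\<Sum>j<?n. (if e i = g \<otimes>\<^bsub>G\<^esub> e j then 1 else 0) * (if e j = h \<otimes>\<^bsub>G\<^esub> e l then 1 else 0))"
      using il by (simp add: \<rho>_def scalar_prod_def atLeast0LessThan)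
    also have "\<dots> = (\<Sum>x\<in>carrier G. (if e i = g \<otimes>\<^bsub>G\<^esub> x then 1 else 0) * (if x = h \<otimes>\<^bsub>G\<^esub> e l then 1 else 0))"
      by (rule sum.reindex_bij_betw[OF e])
    also have "\<dots> = (\<Sum>x\<in>carrier G. if x = h \<otimes>\<^bsub>G\<^esub> e l then (if e i = g \<otimes>\<^bsub>G\<^esub> x then 1 else 0) else 0)"
      by (intro sum.cong) auto
    also have "\<dots> = \<rho> (g \<otimes>\<^bsub>G\<^esub> h) $$ (i, l)"
      using il gh ec[OF il(2)] fin by (simp add: \<rho>_def m_assoc)
    finally show "\<rho> (g \<otimes>\<^bsub>G\<^esub> h) $$ (i, l) = (\<rho> g * \<rho> h) $$ (i, l)" by simp
  qed (auto simp: \<rho>_def)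
  have one: "\<rho> \<one>\<^bsub>G\<^esub> = 1\<^sub>m ?n"
  proof (rule eq_matI)
    fix i j assume "i < dim_row (1\<^sub>m ?n)" "j < dim_col (1\<^sub>m ?n)"
    then show "\<rho> \<one>\<^bsub>G\<^esub> $$ (i, j) = 1\<^sub>m ?n $$ (i, j)"
      using ec inj_onD[OF bij_betw_imp_inj_on[OF e], of i j] by (auto simp: \<rho>_def)
  qed (auto simp: \<rho>_def)
  have "?n > 0" using fin by (auto simp: order_def card_gt_0_iff)
  have "carrier G \<noteq> {\<one>\<^bsub>G\<^esub>}" using nt by (auto simp: order_def)
  then obtain g where g: "g \<in> carrier G" "g \<noteq> \<one>\<^bsub>G\<^esub>" by auto
  \<comment> \<open>Left multiplication by a non-identity element has no fixed point, so the
    diagonal of \<open>\<rho> g\<close> vanishes; one entry suffices.\<close>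
  have "e 0 \<noteq> g \<otimes>\<^bsub>G\<^esub> e 0" using g ec[OF \<open>?n > 0\<close>] by (metis r_cancel_one)
  then have "\<rho> g $$ (0, 0) \<noteq> 1\<^sub>m ?n $$ (0, 0)" using \<open>?n > 0\<close> by (simp add: \<rho>_def)
  then have "\<rho> g \<noteq> 1\<^sub>m ?n" by auto
  then show ?thesis
    unfolding nontrivial_representation_def is_representation_iff[OF G]
    using g mult one by (intro exI[of _ \<rho>]) (auto simp: \<rho>_def)
qed

section \<open>Sums of matrices indexed by a set\<close>

text \<open>The size \<open>d\<close> is a parameter because the type of matrices does not determine
  it; the empty sum is then the zero matrix of size \<open>d\<close>.\<close>

definition mat_sum :: "nat \<Rightarrow> ('a \<Rightarrow> complex mat) \<Rightarrow> 'a set \<Rightarrow> complex mat" where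
  "mat_sum d f S = mat d d (\<lambda>ij. \<Sum>x\<in>S. f x $$ ij)"

lemma mat_sum_carrier [simp]: "mat_sum d f S \<in> carrier_mat d d"
  by (simp add: mat_sum_def)

lemma mat_sum_dim [simp]: "dim_row (mat_sum d f S) = d" "dim_col (mat_sum d f S) = d"
  by (simp_all add: mat_sum_def)

lemma index_mult_mat_sum:
  fixes A B :: "'a :: semiring_0 mat"
  assumes "A \<in> carrier_mat n k" "B \<in> carrier_mat k m" "i < n" "j < m"
  shows "(A * B) $$ (i, j) = (\<Sum>l<k. A $$ (i, l) * B $$ (l, j))"
  using assms by (simp add: scalar_prod_def atLeast0LessThan)

lemma mult_mat_sum:
  assumes A: "A \<in> carrier_mat d d" and f: "\<And>x. x \<in> S \<Longrightarrow> f x \<in> carrier_mat d d"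
  shows "A * mat_sum d f S = mat_sum d (\<lambda>x. A * f x) S"
proof (rule eq_matI)
  fix i j assume "i < dim_row (mat_sum d (\<lambda>x. A * f x) S)" "j < dim_col (mat_sum d (\<lambda>x. A * f x) S)"
  then have ij: "i < d" "j < d" by auto
  have "(A * mat_sum d f S) $$ (i, j) = (\<Sum>l<d. \<Sum>x\<in>S. A $$ (i, l) * f x $$ (l, j))"
    unfolding index_mult_mat_sum[OF A mat_sum_carrier ij] using ij
    by (simp add: mat_sum_def sum_distrib_left)
  also have "\<dots> = (\<Sum>x\<in>S. (A * f x) $$ (i, j))"
    unfolding sum.swap[of _ S "{..<d}"] by (intro sum.cong) (auto simp: index_mult_mat_sum[OF A f ij])
  finally show "(A * mat_sum d f S) $$ (i, j) = mat_sum d (\<lambda>x. A * f x) S $$ (i, j)"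
    using ij by (simp add: mat_sum_def)
qed (use A in auto)

lemma mat_sum_mult:
  assumes A: "A \<in> carrier_mat d d" and f: "\<And>x. x \<in> S \<Longrightarrow> f x \<in> carrier_mat d d"
  shows "mat_sum d f S * A = mat_sum d (\<lambda>x. f x * A) S"
proof (rule eq_matI)
  fix i j assume "i < dim_row (mat_sum d (\<lambda>x. f x * A) S)" "j < dim_col (mat_sum d (\<lambda>x. f x * A) S)"
  then have ij: "i < d" "j < d" by auto
  have "(mat_sum d f S * A) $$ (i, j) = (\<Sum>l<d. \<Sum>x\<in>S. f x $$ (i, l) * A $$ (l, j))"
    unfolding index_mult_mat_sum[OF mat_sum_carrier A ij] using ij
    by (simp add: mat_sum_def sum_distrib_right)
  also have "\<dots> = (\<Sum>x\<in>S. (f x * A) $$ (i, j))"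
    unfolding sum.swap[of _ S "{..<d}"] by (intro sum.cong) (auto simp: index_mult_mat_sum[OF f A ij])
  finally show "(mat_sum d f S * A) $$ (i, j) = mat_sum d (\<lambda>x. f x * A) S $$ (i, j)"
    using ij by (simp add: mat_sum_def)
qed (use A in auto)

lemma mat_sum_cong:
  "(\<And>x. x \<in> S \<Longrightarrow> f x = g x) \<Longrightarrow> mat_sum d f S = mat_sum d g S"
  by (simp add: mat_sum_def)

lemma mat_sum_reindex:
  assumes "bij_betw h S T"
  shows "mat_sum d (\<lambda>x. f (h x)) S = mat_sum d f T"
  unfolding mat_sum_def using sum.reindex_bij_betw[OF assms, where g = "\<lambda>x. f x $$ _"]
  by (intro cong_mat) simp_all

lemma mat_sum_const:
  assumes "A \<in> carrier_mat d d"
  shows "mat_sum d (\<lambda>_. A) S = of_nat (card S) \<cdot>\<^sub>m A"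
  using assms by (intro eq_matI) (auto simp: mat_sum_def)

section \<open>Left inverses and factorizations of full rank\<close>

text \<open>With \<open>XH\<close> the conjugate transpose, \<open>XH * X\<close> is invertible: if
  it annihilates \<open>v\<close>, then the squared length of \<open>w = X v\<close> is the inner
  product of \<open>v\<close> with \<open>XH w = 0\<close>, so \<open>w = 0\<close> and
  \<open>v = 0\<close>. The left inverse is the inverse of \<open>XH * X\<close> times
  \<open>XH\<close>.\<close>

lemma left_inverse_exists:
  fixes X :: "complex mat"
  assumes X: "X \<in> carrier_mat d r"
    and inj: "\<And>v. v \<in> carrier_vec r \<Longrightarrow> X *\<^sub>v v = 0\<^sub>v d \<Longrightarrow> v = 0\<^sub>v r"
  shows "\<exists>X'\<in>carrier_mat r d. X' * X = 1\<^sub>m r"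
proof -
  define XH where "XH = mat r d (\<lambda>(i, j). cnj (X $$ (j, i)))"
  have XH: "XH \<in> carrier_mat r d" by (simp add: XH_def)
  have XX: "XH * X \<in> carrier_mat r r" using XH X by simp
  have "det (XH * X) \<noteq> 0"
  proof
    assume "det (XH * X) = 0"
    then obtain v where v: "v \<in> carrier_vec r" "v \<noteq> 0\<^sub>v r" "(XH * X) *\<^sub>v v = 0\<^sub>v r"
      using det_0_iff_vec_prod_zero[OF XX] by auto
    define w where "w = X *\<^sub>v v"
    have w: "w \<in> carrier_vec d" using X v by (simp add: w_def)
    have XHw: "XH *\<^sub>v w = 0\<^sub>v r" using v X XH by (simp add: w_def)
    have wi: "w $ j = (\<Sum>i<r. X $$ (j, i) * v $ i)" if "j < d" for j
      using that X v by (simp add: w_def scalar_prod_def atLeast0LessThan)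
    have zero: "(\<Sum>j<d. cnj (X $$ (j, i)) * w $ j) = 0" if "i < r" for i
    proof -
      have "(XH *\<^sub>v w) $ i = (\<Sum>j<d. cnj (X $$ (j, i)) * w $ j)"
        using that w by (simp add: XH_def scalar_prod_def atLeast0LessThan)
      then show ?thesis using XHw that by simp
    qed
    have "(\<Sum>j<d. cnj (w $ j) * w $ j) = (\<Sum>j<d. \<Sum>i<r. cnj (v $ i) * (cnj (X $$ (j, i)) * w $ j))"
    proof (rule sum.cong, simp)
      fix j assume "j \<in> {..<d}"
      then have "cnj (w $ j) = (\<Sum>i<r. cnj (v $ i) * cnj (X $$ (j, i)))"
        by (simp add: wi mult.commute)
      then show "cnj (w $ j) * w $ j = (\<Sum>i<r. cnj (v $ i) * (cnj (X $$ (j, i)) * w $ j))"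
        by (simp add: sum_distrib_right mult.assoc)
    qed
    also have "\<dots> = (\<Sum>i<r. cnj (v $ i) * (\<Sum>j<d. cnj (X $$ (j, i)) * w $ j))"
      by (subst sum.swap) (simp add: sum_distrib_left)
    also have "\<dots> = 0" using zero by simp
    finally have "complex_of_real (\<Sum>j<d. (cmod (w $ j))\<^sup>2) = 0"
      by (simp only: of_real_sum complex_norm_square mult.commute)
    then have "(\<Sum>j<d. (cmod (w $ j))\<^sup>2) = 0" by (simp only: of_real_eq_0_iff)
    then have "\<forall>j<d. w $ j = 0" by (subst (asm) sum_nonneg_eq_0_iff) auto
    then have "w = 0\<^sub>v d" using w by (intro eq_vecI) auto
    then show False using inj[OF v(1)] v(2) by (simp add: w_def)
  qed
  then obtain Z where Z: "Z \<in> carrier_mat r r" "Z * (XH * X) = 1\<^sub>m r"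
    using det_non_zero_imp_unit[OF XX, of "()"] by (auto simp: Units_def ring_mat_simps)
  then show ?thesis using XH X by (intro bexI[of _ "Z * XH"]) auto
qed

text \<open>The vector \<open>v\<close> is a linear relation between the columns of
  \<open>X\<close>. An index \<open>k\<close> with \<open>v $ k \<noteq> 0\<close> lets column
  \<open>k\<close> be expressed by the others; it is deleted and its contribution is moved into the
  remaining rows of \<open>Y\<close>.\<close>

lemma factorization_reduce:
  fixes X Y :: "complex mat"
  assumes X: "X \<in> carrier_mat d r" and Y: "Y \<in> carrier_mat r e"
    and v: "v \<in> carrier_vec r" "v \<noteq> 0\<^sub>v r" "X *\<^sub>v v = 0\<^sub>v d"
  shows "\<exists>r'<r. \<exists>X'\<in>carrier_mat d r'. \<exists>Y'\<in>carrier_mat r' e. X' * Y' = X * Y"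
proof -
  obtain k where k: "k < r" "v $ k \<noteq> 0" using v(1,2) by (metis carrier_vecD eq_vecI index_zero_vec)
  obtain s where s: "bij_betw s {..<r - 1} ({..<r} - {k})"
    using ex_bij_betw_nat_finite[of "{..<r} - {k}"] k by (auto simp: atLeast0LessThan)
  define X' where "X' = mat d (r - 1) (\<lambda>(i, j). X $$ (i, s j))"
  define Y' where "Y' = mat (r - 1) e (\<lambda>(j, l). Y $$ (s j, l) - v $ s j / v $ k * Y $$ (k, l))"
  have XY': "X' \<in> carrier_mat d (r - 1)" "Y' \<in> carrier_mat (r - 1) e" by (auto simp: X'_def Y'_def)
  have "X' * Y' = X * Y"
  proof (rule eq_matI)
    fix i l assume "i < dim_row (X * Y)" "l < dim_col (X * Y)"
    then have il: "i < d" "l < e" using X Y by auto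
    have "(X *\<^sub>v v) $ i = (\<Sum>j<r. X $$ (i, j) * v $ j)"
      using il X v(1) by (simp add: scalar_prod_def atLeast0LessThan)
    then have "0 = (\<Sum>j<r. X $$ (i, j) * v $ j)" using il v by simp
    then have Xk: "(\<Sum>j\<in>{..<r} - {k}. X $$ (i, j) * v $ j) = - (X $$ (i, k) * v $ k)"
      using k by (simp add: sum.remove[of "{..<r}" k] add_eq_0_iff)
    have "(X' * Y') $$ (i, l) = (\<Sum>j<r - 1. X $$ (i, s j) * (Y $$ (s j, l) - v $ s j / v $ k * Y $$ (k, l)))"
      unfolding index_mult_mat_sum[OF XY' il] using il by (simp add: X'_def Y'_def)
    also have "\<dots> = (\<Sum>j\<in>{..<r} - {k}. X $$ (i, j) * (Y $$ (j, l) - v $ j / v $ k * Y $$ (k, l)))"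
      by (rule sum.reindex_bij_betw[OF s])
    also have "\<dots> = (\<Sum>j\<in>{..<r} - {k}. X $$ (i, j) * Y $$ (j, l))
        - (\<Sum>j\<in>{..<r} - {k}. X $$ (i, j) * v $ j) * (Y $$ (k, l) / v $ k)"
      by (simp add: right_diff_distrib sum_subtractf sum_distrib_right mult_ac sum_divide_distrib sum_distrib_left)
    also have "\<dots> = (\<Sum>j<r. X $$ (i, j) * Y $$ (j, l))"
      unfolding Xk using k by (simp add: sum.remove[of "{..<r}" k])
    finally show "(X' * Y') $$ (i, l) = (X * Y) $$ (i, l)"
      by (simp add: index_mult_mat_sum[OF X Y il])
  qed (use X Y XY' in auto)
  then show ?thesis using XY' k by (intro exI[of _ "r - 1"]) auto
qed

lemma full_rank_factorization:
  fixes B :: "complex mat"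
  assumes B: "B \<in> carrier_mat d d" and det: "det B = 0" and nz: "B \<noteq> 0\<^sub>m d d"
  obtains r X Y X' Y' where "0 < r" "r < d"
    "X \<in> carrier_mat d r" "Y \<in> carrier_mat r d" "X' \<in> carrier_mat r d" "Y' \<in> carrier_mat d r"
    "B = X * Y" "X' * X = 1\<^sub>m r" "Y * Y' = 1\<^sub>m r"
proof -
  \<comment> \<open>A factorization with minimal inner dimension has full rank, because a linear relation
    between the columns of \<open>X\<close> or the rows of \<open>Y\<close> would allow a shorter one.\<close>
  define fac where "fac r \<longleftrightarrow> (\<exists>X\<in>carrier_mat d r. \<exists>Y\<in>carrier_mat r d. X * Y = B)" for r
  have "fac d" unfolding fac_def using B by (intro bexI[of _ B] bexI[of _ "1\<^sub>m d"]) auto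
  define r where "r = (LEAST r. fac r)"
  have "fac r" unfolding r_def using \<open>fac d\<close> by (rule LeastI)
  have min: "\<not> fac r'" if "r' < r" for r' using that not_less_Least unfolding r_def by blast
  have "r \<le> d" unfolding r_def using \<open>fac d\<close> by (rule Least_le)
  obtain X Y where X: "X \<in> carrier_mat d r" and Y: "Y \<in> carrier_mat r d" and XY: "X * Y = B"
    using \<open>fac r\<close> unfolding fac_def by auto
  have "\<exists>X'\<in>carrier_mat r d. X' * X = 1\<^sub>m r"
  proof (rule left_inverse_exists[OF X], rule ccontr)
    fix v assume "v \<in> carrier_vec r" "X *\<^sub>v v = 0\<^sub>v d" "v \<noteq> 0\<^sub>v r"
    then show False using factorization_reduce[OF X Y] min XY unfolding fac_def by metis
  qed
  then obtain X' where X': "X' \<in> carrier_mat r d" "X' * X = 1\<^sub>m r" by auto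
  \<comment> \<open>A right inverse of \<open>Y\<close> is the transpose of a left inverse of
    \<open>Y\<^sup>T\<close>. Since \<open>Y\<^sup>T * X\<^sup>T\<close> factorizes the transpose of
    \<open>B\<close>, the same minimality argument applies.\<close>
  have YT: "Y\<^sup>T \<in> carrier_mat d r" and XT: "X\<^sup>T \<in> carrier_mat r d" using X Y by auto
  have "\<exists>Z\<in>carrier_mat r d. Z * Y\<^sup>T = 1\<^sub>m r"
  proof (rule left_inverse_exists[OF YT], rule ccontr)
    fix v assume "v \<in> carrier_vec r" "Y\<^sup>T *\<^sub>v v = 0\<^sub>v d" "v \<noteq> 0\<^sub>v r"
    then obtain r' P Q where *: "r' < r" "P \<in> carrier_mat d r'" "Q \<in> carrier_mat r' d" "P * Q = Y\<^sup>T * X\<^sup>T"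
      using factorization_reduce[OF YT XT] by metis
    have "Q\<^sup>T * P\<^sup>T = (P * Q)\<^sup>T" using transpose_mult[OF *(2,3)] by simp
    also have "\<dots> = B" unfolding *(4) XY[symmetric] transpose_mult[OF X Y, symmetric] by simp
    finally have "fac r'" unfolding fac_def using *(2,3)
      by (intro bexI[of _ "Q\<^sup>T"] bexI[of _ "P\<^sup>T"]) auto
    then show False using min *(1) by auto
  qed
  then obtain Z where Z: "Z \<in> carrier_mat r d" "Z * Y\<^sup>T = 1\<^sub>m r" by auto
  have YZ: "Y * Z\<^sup>T = 1\<^sub>m r" using transpose_mult[OF Z(1) YT] Z(2) by simp
  have "r \<noteq> 0"
  proof
    assume "r = 0"
    then have "B = 0\<^sub>m d d" using X Y unfolding XY[symmetric] by (intro eq_matI) (auto simp: scalar_prod_def)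
    then show False using nz by simp
  qed
  \<comment> \<open>For \<open>r = d\<close> both factors would be square with a one-sided inverse,
    and \<open>det B\<close> would not vanish.\<close>
  moreover have "r \<noteq> d"
  proof
    assume "r = d"
    then have "det X' * det X = 1" "det Y * det Z\<^sup>T = 1"
      using det_mult[of X' d X] det_mult[of Y d "Z\<^sup>T"] X X' Y Z YZ by auto
    moreover have "det X * det Y = 0" using det_mult[of X d Y] X Y XY det \<open>r = d\<close> by simp
    ultimately show False by auto
  qed
  ultimately show thesis using that[of r X Y X' "Z\<^sup>T"] X Y X' Z YZ XY \<open>r \<le> d\<close> by auto
qed

section \<open>Schur's lemma in minimal dimension\<close>

text \<open>For \<open>B \<noteq> 0\<close> the column space of \<open>B\<close> is invariant and of
  dimension \<open>r < d\<close>. By minimality the action on it is trivial, so every column of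
  \<open>B\<close> is fixed.\<close>

lemma representation_fixes_singular_commutant:
  assumes G: "group G"
    and nt: "nontrivial_representation G d \<rho>"
    and minimal: "\<And>e \<sigma>. e < d \<Longrightarrow> \<not> nontrivial_representation G e \<sigma>"
    and B: "B \<in> carrier_mat d d" "det B = 0"
    and comm: "\<And>g. g \<in> carrier G \<Longrightarrow> \<rho> g * B = B * \<rho> g"
    and g: "g \<in> carrier G"
  shows "\<rho> g * B = B"
proof (cases "B = 0\<^sub>m d d")
  case True
  have "\<rho> g \<in> carrier_mat d d"
    using nt g unfolding nontrivial_representation_def is_representation_iff[OF G] by simp
  then show ?thesis using True by simp
next
  case False
  interpret group G by fact
  have \<rho>: "\<rho> x \<in> carrier_mat d d" if "x \<in> carrier G" for x
    using nt that unfolding nontrivial_representation_def is_representation_iff[OF G] by simp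
  have mult: "\<rho> (x \<otimes>\<^bsub>G\<^esub> y) = \<rho> x * \<rho> y" if "x \<in> carrier G" "y \<in> carrier G" for x y
    using nt that unfolding nontrivial_representation_def is_representation_iff[OF G] by simp
  have one: "\<rho> \<one>\<^bsub>G\<^esub> = 1\<^sub>m d"
    using nt unfolding nontrivial_representation_def is_representation_iff[OF G] by simp
  obtain r X Y X' Y' where r: "0 < r" "r < d"
    and X: "X \<in> carrier_mat d r" and Y: "Y \<in> carrier_mat r d"
    and X': "X' \<in> carrier_mat r d" and Y': "Y' \<in> carrier_mat d r"
    and fac: "B = X * Y" "X' * X = 1\<^sub>m r" "Y * Y' = 1\<^sub>m r"
    using full_rank_factorization[OF B False] by metis
  \<comment> \<open>\<open>\<sigma>\<close> is the restriction of \<open>\<rho>\<close> to the column space of \<open>B\<close>.\<close>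
  define \<sigma> where "\<sigma> x = Y * \<rho> x * Y'" for x
  have \<sigma>: "\<sigma> x \<in> carrier_mat r r" if "x \<in> carrier G" for x
    using \<rho>[OF that] Y Y' unfolding \<sigma>_def by simp
  \<comment> \<open>Inserting \<open>Y * Y'\<close>, which is the identity, after \<open>X\<close>
    makes \<open>B = X * Y\<close> appear, and \<open>B\<close> can be moved past
    \<open>\<rho> x\<close>.\<close>
  have intertwine: "\<rho> x * X = X * \<sigma> x" if x: "x \<in> carrier G" for x
  proof -
    have "\<rho> x * X = \<rho> x * (X * (Y * Y'))" using fac(3) X by simp
    also have "\<dots> = \<rho> x * ((X * Y) * Y')" using assoc_mult_mat[OF X Y Y'] by simp
    also have "\<dots> = \<rho> x * B * Y'"
      unfolding fac(1)[symmetric] using assoc_mult_mat[OF \<rho>[OF x] B(1) Y'] by simp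
    also have "\<dots> = X * Y * \<rho> x * Y'" by (simp only: comm[OF x] fac(1)[symmetric])
    also have "\<dots> = X * (Y * \<rho> x) * Y'" using assoc_mult_mat[OF X Y \<rho>[OF x]] by simp
    also have "\<dots> = X * \<sigma> x"
      unfolding \<sigma>_def by (rule assoc_mult_mat[OF X _ Y']) (use Y \<rho>[OF x] in simp)
    finally show ?thesis .
  qed
  have cancel: "M = N" if "M \<in> carrier_mat r r" "N \<in> carrier_mat r r" "X * M = X * N" for M N
  proof -
    have "X' * X * M = X' * X * N"
      using assoc_mult_mat[OF X' X that(1)] assoc_mult_mat[OF X' X that(2)] that(3) by simp
    then show ?thesis using that fac(2) by simp
  qed
  have "\<sigma> (x \<otimes>\<^bsub>G\<^esub> y) = \<sigma> x * \<sigma> y" if xy: "x \<in> carrier G" "y \<in> carrier G" for x y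
  proof (rule cancel)
    have "X * \<sigma> (x \<otimes>\<^bsub>G\<^esub> y) = \<rho> x * \<rho> y * X"
      using intertwine[of "x \<otimes>\<^bsub>G\<^esub> y"] xy by (simp add: mult)
    also have "\<dots> = \<rho> x * (X * \<sigma> y)"
      using assoc_mult_mat[OF \<rho>[OF xy(1)] \<rho>[OF xy(2)] X] intertwine[OF xy(2)] by simp
    also have "\<dots> = X * \<sigma> x * \<sigma> y"
      using assoc_mult_mat[OF \<rho>[OF xy(1)] X \<sigma>[OF xy(2)]] intertwine[OF xy(1)] by simp
    also have "\<dots> = X * (\<sigma> x * \<sigma> y)" by (rule assoc_mult_mat[OF X \<sigma>[OF xy(1)] \<sigma>[OF xy(2)]])
    finally show "X * \<sigma> (x \<otimes>\<^bsub>G\<^esub> y) = X * (\<sigma> x * \<sigma> y)" .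
  qed (use \<sigma> xy in \<open>auto intro!: mult_carrier_mat\<close>)
  moreover have "\<sigma> \<one>\<^bsub>G\<^esub> = 1\<^sub>m r" using Y fac(3) by (simp add: \<sigma>_def one)
  ultimately have "is_representation G r \<sigma>"
    unfolding is_representation_iff[OF G] using \<sigma> by blast
  then have "\<sigma> g = 1\<^sub>m r"
    using minimal[OF r(2), of \<sigma>] g unfolding nontrivial_representation_def by blast
  then have "\<rho> g * X = X" using intertwine[OF g] X by simp
  then show ?thesis using fac(1) assoc_mult_mat[OF \<rho>[OF g] X Y] by simp
qed

lemma left_mult_bij:
  assumes "group G" "h \<in> carrier G"
  shows "bij_betw (\<lambda>g. h \<otimes>\<^bsub>G\<^esub> g) (carrier G) (carrier G)"
proof -
  interpret group G by fact
  show ?thesis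
    using assms(2) by (intro bij_betw_byWitness[where f' = "\<lambda>g. inv\<^bsub>G\<^esub> h \<otimes>\<^bsub>G\<^esub> g"])
      (auto simp: m_assoc[symmetric])
qed

lemma right_mult_bij:
  assumes "group G" "h \<in> carrier G"
  shows "bij_betw (\<lambda>g. g \<otimes>\<^bsub>G\<^esub> h) (carrier G) (carrier G)"
proof -
  interpret group G by fact
  show ?thesis
    using assms(2) by (intro bij_betw_byWitness[where f' = "\<lambda>g. g \<otimes>\<^bsub>G\<^esub> inv\<^bsub>G\<^esub> h"])
      (auto simp: m_assoc)
qed

text \<open>Let \<open>n = order G\<close> and let \<open>S\<close> be the sum of all
  \<open>\<rho> g\<close>. Every \<open>\<rho> g\<close> fixes \<open>B\<close>, so
  \<open>S * B\<close> is \<open>n\<close> times \<open>B\<close> and \<open>C = n - S\<close>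
  annihilates \<open>B\<close>; if \<open>B\<close> is nonzero, \<open>C\<close> is singular. As
  \<open>C\<close> commutes with the action, \<open>\<rho> h * C = C\<close>. Comparing this with
  \<open>\<rho> h * C = n \<rho> h - S\<close> gives \<open>\<rho> h = 1\<close> for all
  \<open>h\<close>, against non-triviality.\<close>

lemma minimal_representation_singular_commutant:
  assumes G: "group G" and fin: "finite (carrier G)"
    and nt: "nontrivial_representation G d \<rho>"
    and minimal: "\<And>e \<sigma>. e < d \<Longrightarrow> \<not> nontrivial_representation G e \<sigma>"
    and B: "B \<in> carrier_mat d d" "det B = 0"
    and comm: "\<And>g. g \<in> carrier G \<Longrightarrow> \<rho> g * B = B * \<rho> g"
  shows "B = 0\<^sub>m d d"
proof (rule ccontr)
  assume nz: "B \<noteq> 0\<^sub>m d d"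
  interpret group G by fact
  have \<rho>: "\<rho> x \<in> carrier_mat d d" if "x \<in> carrier G" for x
    using nt that unfolding nontrivial_representation_def is_representation_iff[OF G] by simp
  have mult: "\<rho> (x \<otimes>\<^bsub>G\<^esub> y) = \<rho> x * \<rho> y" if "x \<in> carrier G" "y \<in> carrier G" for x y
    using nt that unfolding nontrivial_representation_def is_representation_iff[OF G] by simp
  define S where "S = mat_sum d \<rho> (carrier G)"
  have S: "S \<in> carrier_mat d d" by (simp add: S_def)
  let ?n = "of_nat (order G) :: complex"
  have n0: "?n \<noteq> 0" using fin one_closed by (auto simp: order_def)
  have hS: "\<rho> h * S = S" if h: "h \<in> carrier G" for h
  proof -
    have "\<rho> h * S = mat_sum d (\<lambda>g. \<rho> h * \<rho> g) (carrier G)"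
      unfolding S_def by (rule mult_mat_sum[OF \<rho>[OF h] \<rho>])
    also have "\<dots> = mat_sum d (\<lambda>g. \<rho> (h \<otimes>\<^bsub>G\<^esub> g)) (carrier G)"
      by (rule mat_sum_cong) (simp add: mult h)
    also have "\<dots> = S" unfolding S_def by (rule mat_sum_reindex[OF left_mult_bij[OF G h]])
    finally show ?thesis .
  qed
  have Sh: "S * \<rho> h = S" if h: "h \<in> carrier G" for h
  proof -
    have "S * \<rho> h = mat_sum d (\<lambda>g. \<rho> g * \<rho> h) (carrier G)"
      unfolding S_def by (rule mat_sum_mult[OF \<rho>[OF h] \<rho>])
    also have "\<dots> = mat_sum d (\<lambda>g. \<rho> (g \<otimes>\<^bsub>G\<^esub> h)) (carrier G)"
      by (rule mat_sum_cong) (simp add: mult h)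
    also have "\<dots> = S" unfolding S_def by (rule mat_sum_reindex[OF right_mult_bij[OF G h]])
    finally show ?thesis .
  qed
  \<comment> \<open>\<open>S / n\<close> is the projection onto the fixed vectors; the complementary projection \<open>C / n\<close> is
    again singular and commutes with \<open>\<rho>\<close>, so \<open>\<rho>\<close> acts trivially on both summands.\<close>
  define C where "C = ?n \<cdot>\<^sub>m 1\<^sub>m d - S"
  have C: "C \<in> carrier_mat d d" unfolding C_def by (intro minus_carrier_mat S)
  have nI: "?n \<cdot>\<^sub>m 1\<^sub>m d \<in> carrier_mat d d" by simp
  have hC: "\<rho> h * C = ?n \<cdot>\<^sub>m \<rho> h - S" if h: "h \<in> carrier G" for h
    unfolding C_def using mult_minus_distrib_mat[OF \<rho>[OF h] nI S] hS[OF h] \<rho>[OF h]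
      mult_smult_distrib[OF \<rho>[OF h], of "1\<^sub>m d" d ?n] by simp
  have Ch: "C * \<rho> h = ?n \<cdot>\<^sub>m \<rho> h - S" if h: "h \<in> carrier G" for h
    unfolding C_def using minus_mult_distrib_mat[OF nI S \<rho>[OF h]] Sh[OF h] \<rho>[OF h]
      mult_smult_assoc_mat[of "1\<^sub>m d" d d "\<rho> h" d ?n] by simp
  have "S * B = mat_sum d (\<lambda>g. \<rho> g * B) (carrier G)"
    unfolding S_def by (rule mat_sum_mult[OF B(1) \<rho>])
  also have "\<dots> = mat_sum d (\<lambda>g. B) (carrier G)"
    by (rule mat_sum_cong) (rule representation_fixes_singular_commutant[OF G nt minimal B comm])
  also have "\<dots> = ?n \<cdot>\<^sub>m B" using mat_sum_const[OF B(1)] by (simp add: order_def)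
  finally have SB: "S * B = ?n \<cdot>\<^sub>m B" .
  have CB: "C * B = 0\<^sub>m d d"
    unfolding C_def using minus_mult_distrib_mat[OF nI S B(1)] SB B(1)
      mult_smult_assoc_mat[of "1\<^sub>m d" d d B d ?n] by auto
  have "det C = 0"
  proof (rule ccontr)
    assume "det C \<noteq> 0"
    then obtain Z where Z: "Z \<in> carrier_mat d d" "Z * C = 1\<^sub>m d"
      using det_non_zero_imp_unit[OF C, of "()"] by (auto simp: Units_def ring_mat_simps)
    have "B = Z * C * B" using Z B by simp
    also have "\<dots> = Z * (C * B)" by (rule assoc_mult_mat[OF Z(1) C B(1)])
    also have "\<dots> = 0\<^sub>m d d" using Z CB by simp
    finally show False using nz by simp
  qed
  then have fixed: "\<rho> h * C = C" if "h \<in> carrier G" for h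
    using representation_fixes_singular_commutant[OF G nt minimal C] hC Ch that by simp
  have "\<rho> h = 1\<^sub>m d" if h: "h \<in> carrier G" for h
  proof (rule eq_matI)
    fix i j assume "i < dim_row (1\<^sub>m d)" "j < dim_col (1\<^sub>m d)"
    then have ij: "i < d" "j < d" by auto
    have "(?n \<cdot>\<^sub>m \<rho> h - S) $$ (i, j) = (?n \<cdot>\<^sub>m 1\<^sub>m d - S) $$ (i, j)"
      using fixed[OF h] hC[OF h] C_def by simp
    then show "\<rho> h $$ (i, j) = 1\<^sub>m d $$ (i, j)"
      using ij S \<rho>[OF h] n0 by (auto split: if_splits)
  qed (use \<rho>[OF h] in auto)
  then show False using nt unfolding nontrivial_representation_def by blast
qed

text \<open>Over the complex numbers \<open>A\<close> has an eigenvalue \<open>c\<close>, as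
  \<open>d > 0\<close>. Then \<open>A - c\<close> is singular and commutes with the action, hence is
  zero.\<close>

lemma minimal_representation_commutant_scalar:
  assumes G: "group G" and fin: "finite (carrier G)"
    and nt: "nontrivial_representation G d \<rho>"
    and minimal: "\<And>e \<sigma>. e < d \<Longrightarrow> \<not> nontrivial_representation G e \<sigma>"
    and A: "A \<in> carrier_mat d d"
    and comm: "\<And>g. g \<in> carrier G \<Longrightarrow> \<rho> g * A = A * \<rho> g"
  shows "\<exists>c. A = c \<cdot>\<^sub>m 1\<^sub>m d"
proof -
  have \<rho>: "\<rho> x \<in> carrier_mat d d" if "x \<in> carrier G" for x
    using nt that unfolding nontrivial_representation_def is_representation_iff[OF G] by simp
  have "d > 0" using nontrivial_representation_dim_pos[OF G nt] .
  then obtain c where "eigenvalue A c" using spectrum_non_empty[OF A] by (auto simp: spectrum_def)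
  then obtain v where v: "v \<in> carrier_vec d" "v \<noteq> 0\<^sub>v d" "A *\<^sub>v v = c \<cdot>\<^sub>v v"
    using A by (auto simp: eigenvalue_def eigenvector_def)
  define B where "B = A - c \<cdot>\<^sub>m 1\<^sub>m d"
  have cI: "c \<cdot>\<^sub>m 1\<^sub>m d \<in> carrier_mat d d" by simp
  have B: "B \<in> carrier_mat d d" unfolding B_def by (intro minus_carrier_mat cI)
  have "c \<cdot>\<^sub>m 1\<^sub>m d *\<^sub>v v = c \<cdot>\<^sub>v v" using v(1) by (intro eq_vecI) auto
  then have "B *\<^sub>v v = 0\<^sub>v d"
    unfolding B_def using minus_mult_distrib_mat_vec[OF A cI v(1)] v by auto
  then have "det B = 0" using det_0_iff_vec_prod_zero[OF B] v by auto
  moreover have "\<rho> g * B = B * \<rho> g" if g: "g \<in> carrier G" for g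
    unfolding B_def using mult_minus_distrib_mat[OF \<rho>[OF g] A cI] minus_mult_distrib_mat[OF A cI \<rho>[OF g]]
      mult_smult_distrib[OF \<rho>[OF g], of "1\<^sub>m d" d c] mult_smult_assoc_mat[of "1\<^sub>m d" d d "\<rho> g" d c]
      comm[OF g] \<rho>[OF g] by simp
  ultimately have "B = 0\<^sub>m d d" by (intro minimal_representation_singular_commutant[OF G fin nt minimal B])
  have "A = c \<cdot>\<^sub>m 1\<^sub>m d"
  proof (rule eq_matI)
    fix i j assume "i < dim_row (c \<cdot>\<^sub>m 1\<^sub>m d)" "j < dim_col (c \<cdot>\<^sub>m 1\<^sub>m d)"
    then have ij: "i < d" "j < d" by auto
    have "B $$ (i, j) = 0" using \<open>B = 0\<^sub>m d d\<close> ij by simp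
    then show "A $$ (i, j) = (c \<cdot>\<^sub>m 1\<^sub>m d) $$ (i, j)" unfolding B_def using ij A by simp
  qed (use A in auto)
  then show ?thesis ..
qed

section \<open>Bounds for the minimal dimension\<close>

text \<open>In an Abelian group each \<open>\<rho> h\<close> commutes with the action and is
  therefore a scalar \<open>c h\<close>. The function \<open>c\<close> is itself a non-trivial
  representation of dimension 1, which contradicts minimality if \<open>d > 1\<close>.\<close>

lemma minimal_representation_of_comm_group:
  assumes G: "comm_group G" and fin: "finite (carrier G)"
    and nt: "nontrivial_representation G d \<rho>"
    and minimal: "\<And>e \<sigma>. e < d \<Longrightarrow> \<not> nontrivial_representation G e \<sigma>"
  shows "d = 1"
proof (rule ccontr)
  assume "d \<noteq> 1"
  interpret comm_group G by fact
  have \<rho>: "\<rho> x \<in> carrier_mat d d" if "x \<in> carrier G" for x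
    using nt that unfolding nontrivial_representation_def is_representation_iff[OF is_group] by simp
  have mult: "\<rho> (x \<otimes>\<^bsub>G\<^esub> y) = \<rho> x * \<rho> y" if "x \<in> carrier G" "y \<in> carrier G" for x y
    using nt that unfolding nontrivial_representation_def is_representation_iff[OF is_group] by simp
  have one: "\<rho> \<one>\<^bsub>G\<^esub> = 1\<^sub>m d"
    using nt unfolding nontrivial_representation_def is_representation_iff[OF is_group] by simp
  have d: "d > 1" using nontrivial_representation_dim_pos[OF is_group nt] \<open>d \<noteq> 1\<close> by simp
  have "\<exists>c. \<rho> h = c \<cdot>\<^sub>m 1\<^sub>m d" if h: "h \<in> carrier G" for h
    by (rule minimal_representation_commutant_scalar[OF is_group fin nt minimal \<rho>[OF h]])
      (simp_all add: m_comm h flip: mult)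
  then obtain c where c: "\<And>h. h \<in> carrier G \<Longrightarrow> \<rho> h = c h \<cdot>\<^sub>m 1\<^sub>m d" by metis
  have c1: "c \<one>\<^bsub>G\<^esub> = 1"
  proof -
    have "(c \<one>\<^bsub>G\<^esub> \<cdot>\<^sub>m 1\<^sub>m d) $$ (0, 0) = 1\<^sub>m d $$ (0, 0)" using c[of "\<one>\<^bsub>G\<^esub>"] one by simp
    then show ?thesis using d by simp
  qed
  have cm: "c (x \<otimes>\<^bsub>G\<^esub> y) = c x * c y" if xy: "x \<in> carrier G" "y \<in> carrier G" for x y
  proof -
    have "c (x \<otimes>\<^bsub>G\<^esub> y) \<cdot>\<^sub>m 1\<^sub>m d = (c x \<cdot>\<^sub>m 1\<^sub>m d) * (c y \<cdot>\<^sub>m 1\<^sub>m d)"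
      using c[of "x \<otimes>\<^bsub>G\<^esub> y"] c[of x] c[of y] mult[OF xy] xy by simp
    then have "(c (x \<otimes>\<^bsub>G\<^esub> y) \<cdot>\<^sub>m 1\<^sub>m d) $$ (0, 0) = ((c x \<cdot>\<^sub>m 1\<^sub>m d) * (c y \<cdot>\<^sub>m 1\<^sub>m d)) $$ (0, 0)" by simp
    then show ?thesis using d mult_smult_assoc_mat[of "1\<^sub>m d" d d "c y \<cdot>\<^sub>m 1\<^sub>m d" d "c x"] by simp
  qed
  define \<sigma> where "\<sigma> h = c h \<cdot>\<^sub>m 1\<^sub>m 1" for h
  have "is_representation G 1 \<sigma>"
    unfolding is_representation_iff[OF is_group]
  proof (intro conjI ballI)
    fix x y assume xy: "x \<in> carrier G" "y \<in> carrier G"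
    show "\<sigma> (x \<otimes>\<^bsub>G\<^esub> y) = \<sigma> x * \<sigma> y"
      using cm[OF xy] by (intro eq_matI) (auto simp: \<sigma>_def scalar_prod_def)
  qed (auto simp: \<sigma>_def c1)
  moreover have "\<exists>g\<in>carrier G. \<sigma> g \<noteq> 1\<^sub>m 1"
  proof (rule ccontr)
    assume "\<not> ?thesis"
    then have triv: "\<sigma> g $$ (0, 0) = (1\<^sub>m 1 :: complex mat) $$ (0, 0)" if "g \<in> carrier G" for g using that by auto
    have "c g = 1" if "g \<in> carrier G" for g using triv[OF that] by (simp add: \<sigma>_def)
    then have "\<rho> g = 1\<^sub>m d" if "g \<in> carrier G" for g using c[OF that] that by auto
    then show False using nt unfolding nontrivial_representation_def by blast
  qed
  ultimately show False using minimal[OF d] unfolding nontrivial_representation_def by blast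
qed

text \<open>Otherwise the requirement that a combination of the matrix coefficients vanishes at
  every \<open>g\<close> has more unknowns than equations, hence a solution \<open>c\<close> that is
  not identically zero. The orthogonality relations \<open>orth\<close> force every
  \<open>c (l, k)\<close> to vanish.\<close>

lemma minimal_representation_dim_square_le:
  assumes G: "group G" and fin: "finite (carrier G)"
    and nt: "nontrivial_representation G d \<rho>"
    and minimal: "\<And>e \<sigma>. e < d \<Longrightarrow> \<not> nontrivial_representation G e \<sigma>"
  shows "d * d \<le> order G"
proof (rule ccontr)
  assume "\<not> d * d \<le> order G"
  then have card: "card (carrier G) < card ({..<d} \<times> {..<d})" by (simp add: order_def)
  interpret group G by fact
  have \<rho>: "\<rho> x \<in> carrier_mat d d" if "x \<in> carrier G" for x
    using nt that unfolding nontrivial_representation_def is_representation_iff[OF G] by simp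
  have mult: "\<rho> (x \<otimes>\<^bsub>G\<^esub> y) = \<rho> x * \<rho> y" if "x \<in> carrier G" "y \<in> carrier G" for x y
    using nt that unfolding nontrivial_representation_def is_representation_iff[OF G] by simp
  have one: "\<rho> \<one>\<^bsub>G\<^esub> = 1\<^sub>m d"
    using nt unfolding nontrivial_representation_def is_representation_iff[OF G] by simp
  let ?n = "of_nat (order G) :: complex"
  have n0: "?n \<noteq> 0" using fin one_closed by (auto simp: order_def)
  obtain c where c: "\<exists>ij\<in>{..<d} \<times> {..<d}. c ij \<noteq> 0"
    "\<And>g. g \<in> carrier G \<Longrightarrow> (\<Sum>ij\<in>{..<d} \<times> {..<d}. \<rho> g $$ ij * c ij) = 0"
    using nontrivial_solution_exists[OF fin _ card, of "\<lambda>g ij. \<rho> g $$ ij"] by auto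
  \<comment> \<open>The matrix unit \<open>E\<close> at position \<open>(j, k)\<close>, conjugated
    by \<open>\<rho> g\<close> and summed over \<open>g\<close>, commutes with the action and so is
    a scalar \<open>\<mu>\<close>; its entries are the sums in question. The trace determines
    \<open>\<mu>\<close>. The factor \<open>of_nat d\<close> saves a division.\<close>
  have orth: "of_nat d * (\<Sum>g\<in>carrier G. \<rho> g $$ (i, j) * \<rho> (inv\<^bsub>G\<^esub> g) $$ (k, l)) = (if i = l \<and> j = k then ?n else 0)"
    if ij: "i < d" "j < d" and kl: "k < d" "l < d" for i j k l
  proof -
    define E where "E = mat d d (\<lambda>(a, b). if a = j \<and> b = k then 1 else 0 :: complex)"
    have E: "E \<in> carrier_mat d d" by (simp add: E_def)
    define f where "f g = \<rho> g * E * \<rho> (inv\<^bsub>G\<^esub> g)" for g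
    have f: "f g \<in> carrier_mat d d" if "g \<in> carrier G" for g
      unfolding f_def using \<rho>[OF that] \<rho>[OF inv_closed[OF that]] E by simp
    have fi: "f g $$ (a, b) = \<rho> g $$ (a, j) * \<rho> (inv\<^bsub>G\<^esub> g) $$ (k, b)"
      if "g \<in> carrier G" and ab: "a < d" "b < d" for g a b
    proof -
      note r = \<rho>[OF that(1)] \<rho>[OF inv_closed[OF that(1)]]
      have rE: "(\<rho> g * E) $$ (a, t) = (if t = k then \<rho> g $$ (a, j) else 0)" if "t < d" for t
      proof -
        have "(\<rho> g * E) $$ (a, t) = (\<Sum>s<d. if s = j then (if t = k then \<rho> g $$ (a, j) else 0) else 0)"
          unfolding index_mult_mat_sum[OF r(1) E ab(1) that]
          by (intro sum.cong) (auto simp: E_def that)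
        then show ?thesis using ij by simp
      qed
      have "f g $$ (a, b) = (\<Sum>t<d. (\<rho> g * E) $$ (a, t) * \<rho> (inv\<^bsub>G\<^esub> g) $$ (t, b))"
        unfolding f_def by (rule index_mult_mat_sum[OF _ r(2) ab]) (use r(1) E in simp)
      also have "\<dots> = (\<Sum>t<d. if t = k then \<rho> g $$ (a, j) * \<rho> (inv\<^bsub>G\<^esub> g) $$ (k, b) else 0)"
        by (intro sum.cong) (auto simp: rE)
      finally show ?thesis using kl by simp
    qed
    define P where "P = mat_sum d f (carrier G)"
    have P: "P \<in> carrier_mat d d" by (simp add: P_def)
    have "\<rho> h * P = P * \<rho> h" if h: "h \<in> carrier G" for h
    proof -
      \<comment> \<open>Moving \<open>\<rho> h\<close> past a summand of \<open>P\<close> replaces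
        \<open>g\<close> by the product of \<open>h\<close> and \<open>g\<close>, which only
        reorders the sum.\<close>
      have twist: "\<rho> h * f g = f (h \<otimes>\<^bsub>G\<^esub> g) * \<rho> h" if g: "g \<in> carrier G" for g
      proof -
        note r = \<rho>[OF g] \<rho>[OF h] \<rho>[OF inv_closed[OF g]] \<rho>[OF inv_closed[OF h]]
        have "\<rho> (inv\<^bsub>G\<^esub> (h \<otimes>\<^bsub>G\<^esub> g)) * \<rho> h = \<rho> (inv\<^bsub>G\<^esub> g)"
          using g h by (simp add: inv_mult_group m_assoc flip: mult)
        moreover have "f (h \<otimes>\<^bsub>G\<^esub> g) * \<rho> h = \<rho> (h \<otimes>\<^bsub>G\<^esub> g) * E * (\<rho> (inv\<^bsub>G\<^esub> (h \<otimes>\<^bsub>G\<^esub> g)) * \<rho> h)"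
          unfolding f_def using g h E by (intro assoc_mult_mat[of _ d d _ d _ d]) (auto intro!: mult_carrier_mat \<rho>)
        ultimately have "f (h \<otimes>\<^bsub>G\<^esub> g) * \<rho> h = \<rho> h * \<rho> g * E * \<rho> (inv\<^bsub>G\<^esub> g)"
          using g h by (simp add: mult)
        also have "\<dots> = \<rho> h * (\<rho> g * E) * \<rho> (inv\<^bsub>G\<^esub> g)"
          using assoc_mult_mat[OF r(2) r(1) E] by simp
        also have "\<dots> = \<rho> h * f g"
          unfolding f_def by (rule assoc_mult_mat[OF r(2) _ r(3)]) (use r E in simp)
        finally show ?thesis by simp
      qed
      have "\<rho> h * P = mat_sum d (\<lambda>g. \<rho> h * f g) (carrier G)"
        unfolding P_def by (rule mult_mat_sum[OF \<rho>[OF h] f])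
      also have "\<dots> = mat_sum d (\<lambda>g. f (h \<otimes>\<^bsub>G\<^esub> g) * \<rho> h) (carrier G)"
        by (rule mat_sum_cong) (rule twist)
      also have "\<dots> = mat_sum d (\<lambda>g. f g * \<rho> h) (carrier G)"
        by (rule mat_sum_reindex[OF left_mult_bij[OF G h]])
      also have "\<dots> = P * \<rho> h"
        unfolding P_def by (rule mat_sum_mult[OF \<rho>[OF h] f, symmetric])
      finally show ?thesis .
    qed
    then obtain \<mu> where \<mu>: "P = \<mu> \<cdot>\<^sub>m 1\<^sub>m d"
      using minimal_representation_commutant_scalar[OF G fin nt minimal P] by blast
    have Pi: "(\<Sum>g\<in>carrier G. \<rho> g $$ (a, j) * \<rho> (inv\<^bsub>G\<^esub> g) $$ (k, b)) = (if a = b then \<mu> else 0)"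
      if ab: "a < d" "b < d" for a b
    proof -
      have "(\<Sum>g\<in>carrier G. \<rho> g $$ (a, j) * \<rho> (inv\<^bsub>G\<^esub> g) $$ (k, b)) = P $$ (a, b)"
        unfolding P_def mat_sum_def using ab by (simp add: fi)
      then show ?thesis using ab by (simp add: \<mu>)
    qed
    \<comment> \<open>Both sides are the trace of \<open>P\<close>. By cyclicity the summand for
      \<open>g\<close> is the entry \<open>(k, j)\<close> of the product of the matrices of the
      inverse of \<open>g\<close> and of \<open>g\<close>, that is, of the identity.\<close>
    have "of_nat d * \<mu> = (\<Sum>a<d. \<Sum>g\<in>carrier G. \<rho> g $$ (a, j) * \<rho> (inv\<^bsub>G\<^esub> g) $$ (k, a))"
      by (simp add: Pi)
    also have "\<dots> = (\<Sum>g\<in>carrier G. (\<rho> (inv\<^bsub>G\<^esub> g) * \<rho> g) $$ (k, j))"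
      by (subst sum.swap, intro sum.cong refl)
        (simp add: index_mult_mat_sum[OF \<rho>[OF inv_closed] \<rho>] ij kl mult.commute)
    also have "\<dots> = (\<Sum>g\<in>carrier G. if j = k then 1 else 0)"
      by (intro sum.cong) (auto simp: ij kl one simp flip: mult)
    finally have "of_nat d * \<mu> = (if j = k then ?n else 0)" by (simp add: order_def)
    then show ?thesis using Pi[OF ij(1) kl(2)] by (auto split: if_splits)
  qed
  have "c (l, k) = 0" if kl: "k < d" "l < d" for k l
  proof -
    \<comment> \<open>The relation at \<open>g\<close> is paired with the \<open>(k, l)\<close>
      entry at the inverse of \<open>g\<close>; by \<open>orth\<close> only the index
      \<open>(l, k)\<close> survives, with the two positions exchanged.\<close>
    have "0 = (\<Sum>g\<in>carrier G. (\<Sum>ij\<in>{..<d} \<times> {..<d}. \<rho> g $$ ij * c ij) * (of_nat d * \<rho> (inv\<^bsub>G\<^esub> g) $$ (k, l)))"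
      using c(2) by simp
    also have "\<dots> = (\<Sum>ij\<in>{..<d} \<times> {..<d}. \<Sum>g\<in>carrier G. c ij * (of_nat d * (\<rho> g $$ ij * \<rho> (inv\<^bsub>G\<^esub> g) $$ (k, l))))"
      unfolding sum_distrib_right by (subst sum.swap) (simp add: mult_ac)
    also have "\<dots> = (\<Sum>ij\<in>{..<d} \<times> {..<d}. c ij * (of_nat d * (\<Sum>g\<in>carrier G. \<rho> g $$ ij * \<rho> (inv\<^bsub>G\<^esub> g) $$ (k, l))))"
      by (simp only: sum_distrib_left)
    also have "\<dots> = (\<Sum>ij\<in>{..<d} \<times> {..<d}. if ij = (l, k) then c ij * ?n else 0)"
    proof (rule sum.cong[OF refl])
      fix ij assume "ij \<in> {..<d} \<times> {..<d}"
      then obtain a b where ab: "ij = (a, b)" "a < d" "b < d" by auto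
      show "c ij * (of_nat d * (\<Sum>g\<in>carrier G. \<rho> g $$ ij * \<rho> (inv\<^bsub>G\<^esub> g) $$ (k, l)))
          = (if ij = (l, k) then c ij * ?n else 0)"
        unfolding ab(1) orth[OF ab(2,3) kl] by simp
    qed
    also have "\<dots> = c (l, k) * ?n" using kl by simp
    finally show ?thesis using n0 by simp
  qed
  then show False using c(1) by auto
qed

lemma exists_minimal_nontrivial_representation:
  assumes "group G" "finite (carrier G)" "order G \<noteq> 1"
  obtains d \<rho> where "nontrivial_representation G d \<rho>"
    "\<And>e \<sigma>. e < d \<Longrightarrow> \<not> nontrivial_representation G e \<sigma>"
proof -
  let ?P = "\<lambda>d. \<exists>\<rho>. nontrivial_representation G d \<rho>"
  have "?P (LEAST d. ?P d)"
    using regular_representation_nontrivial[OF assms] by (rule LeastI)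
  then show thesis using that not_less_Least[of _ ?P] by blast
qed

section \<open>Invariant norms on matrices\<close>

text \<open>\<open>x\<close> is expanded in the coordinate functions \<open>\<delta> k\<close>, and
  \<open>C\<close> adds up the sizes of their values under \<open>N\<close>. By \<open>dep\<close>,
  \<open>x\<close> can first be cut off outside \<open>I\<close>.\<close>

lemma seminorm_le_sum:
  fixes N :: "('i \<Rightarrow> real) \<Rightarrow> real"
  assumes I: "finite I"
    and tri: "\<And>x y. N (\<lambda>i. x i + y i) \<le> N x + N y"
    and scale: "\<And>c x. N (\<lambda>i. c * x i) = \<bar>c\<bar> * N x"
    and dep: "\<And>x y. (\<And>i. i \<in> I \<Longrightarrow> x i = y i) \<Longrightarrow> N x = N y"
  shows "\<exists>C. \<forall>x. N x \<le> C * (\<Sum>i\<in>I. \<bar>x i\<bar>)"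
proof -
  define \<delta> :: "'i \<Rightarrow> 'i \<Rightarrow> real" where "\<delta> k i = (if i = k then 1 else 0)" for k i
  define C where "C = (\<Sum>i\<in>I. \<bar>N (\<delta> i)\<bar>)"
  have part: "N (\<lambda>i. if i \<in> J then x i else 0) \<le> (\<Sum>i\<in>J. \<bar>x i\<bar> * N (\<delta> i))" if "finite J" for J x
    using that
  proof (induction J rule: finite_induct)
    case empty
    then show ?case using scale[of 0 "\<lambda>_. 0"] by simp
  next
    case (insert k J)
    have "(\<lambda>i. if i \<in> insert k J then x i else 0) = (\<lambda>i. (if i \<in> J then x i else 0) + x k * \<delta> k i)"
      using insert by (auto simp: \<delta>_def)
    then have "N (\<lambda>i. if i \<in> insert k J then x i else 0) \<le> N (\<lambda>i. if i \<in> J then x i else 0) + N (\<lambda>i. x k * \<delta> k i)"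
      using tri[of "\<lambda>i. if i \<in> J then x i else 0" "\<lambda>i. x k * \<delta> k i"] by (simp only:)
    then show ?case using insert scale[of "x k" "\<delta> k"] by simp
  qed
  have "N x \<le> C * (\<Sum>i\<in>I. \<bar>x i\<bar>)" for x
  proof -
    have "N x = N (\<lambda>i. if i \<in> I then x i else 0)" by (rule dep) simp
    also have "\<dots> \<le> (\<Sum>i\<in>I. \<bar>x i\<bar> * N (\<delta> i))" by (rule part[OF I])
    also have "\<dots> \<le> (\<Sum>i\<in>I. \<bar>x i\<bar> * C)"
    proof (intro sum_mono mult_left_mono)
      fix i assume "i \<in> I"
      then have "\<bar>N (\<delta> i)\<bar> \<le> C" unfolding C_def using I by (intro member_le_sum) auto
      then show "N (\<delta> i) \<le> C" by simp
    qed simp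
    also have "\<dots> = C * (\<Sum>i\<in>I. \<bar>x i\<bar>)" by (simp add: sum_distrib_left mult.commute)
    finally show ?thesis .
  qed
  then show ?thesis by blast
qed

text \<open>Real and imaginary parts of the entries identify the matrices with a real space of
  dimension \<open>2 * d * d\<close>, where \<open>separated_set_card_bound\<close> applies. The
  Boolean in an index is \<open>True\<close> for the real part and \<open>False\<close> for the
  imaginary part.\<close>

lemma separated_matrices_card_bound:
  fixes N :: "complex mat \<Rightarrow> real"
  assumes P: "finite P" "P \<subseteq> carrier_mat d d"
    and tri: "\<And>A B. A \<in> carrier_mat d d \<Longrightarrow> B \<in> carrier_mat d d \<Longrightarrow> N (A + B) \<le> N A + N B"
    and scale: "\<And>c A. A \<in> carrier_mat d d \<Longrightarrow> N (c \<cdot>\<^sub>m A) = cmod c * N A"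
    and diam: "\<And>A B. A \<in> P \<Longrightarrow> B \<in> P \<Longrightarrow> N (A - B) \<le> 2"
    and sep: "\<And>A B. A \<in> P \<Longrightarrow> B \<in> P \<Longrightarrow> A \<noteq> B \<Longrightarrow> 1 / 2 \<le> N (A - B)"
  shows "card P \<le> 6 ^ (2 * d * d)"
proof -
  define I :: "(nat \<times> nat \<times> bool) set" where "I = {..<d} \<times> {..<d} \<times> UNIV"
  define mx where "mx x = mat d d (\<lambda>(i, j). Complex (x (i, j, True)) (x (i, j, False)))"
    for x :: "nat \<times> nat \<times> bool \<Rightarrow> real"
  define co where "co A = (\<lambda>(i, j, b). if i < d \<and> j < d then (if b then Re else Im) (A $$ (i, j)) else 0)"
    for A :: "complex mat"
  have mx: "mx x \<in> carrier_mat d d" for x by (simp add: mx_def)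
  have mxco: "mx (co A) = A" if "A \<in> carrier_mat d d" for A
    using that by (intro eq_matI) (auto simp: mx_def co_def)
  have mx_add: "mx (\<lambda>i. x i + y i) = mx x + mx y" for x y
    by (intro eq_matI) (auto simp: mx_def complex_eq_iff)
  have mx_diff: "mx (\<lambda>i. x i - y i) = mx x - mx y" for x y
    by (intro eq_matI) (auto simp: mx_def complex_eq_iff)
  have mx_scale: "mx (\<lambda>i. c * x i) = of_real c \<cdot>\<^sub>m mx x" for c x
    by (intro eq_matI) (auto simp: mx_def complex_eq_iff)
  have mx_cong: "mx x = mx y" if "\<And>i. i \<in> I \<Longrightarrow> x i = y i" for x y
    using that by (intro eq_matI) (auto simp: mx_def I_def)
  have I: "finite I" by (simp add: I_def)
  have tri': "N (mx (\<lambda>i. x i + y i)) \<le> N (mx x) + N (mx y)" for x y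
    unfolding mx_add by (rule tri[OF mx mx])
  have scale': "N (mx (\<lambda>i. c * x i)) = \<bar>c\<bar> * N (mx x)" for c x
    unfolding mx_scale scale[OF mx] by simp
  obtain C where C: "\<And>x. N (mx x) \<le> C * (\<Sum>i\<in>I. \<bar>x i\<bar>)"
    using seminorm_le_sum[OF I, of "\<lambda>x. N (mx x)"] tri' scale' mx_cong by metis
  have inj: "inj_on co P" by (rule inj_on_inverseI[of _ mx]) (use P mxco in auto)
  have "card (co ` P) \<le> 6 ^ card I"
  proof (rule separated_set_card_bound[OF I, of _ "\<lambda>x. N (mx x)" C])
    fix x y assume "x \<in> co ` P" "y \<in> co ` P"
    then obtain A B where AB: "A \<in> P" "B \<in> P" "x = co A" "y = co B" by auto
    then have "A \<in> carrier_mat d d" "B \<in> carrier_mat d d" using P(2) by auto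
    then have eq: "mx (\<lambda>i. x i - y i) = A - B" using AB(3,4) by (simp add: mx_diff mxco)
    show "N (mx (\<lambda>i. x i - y i)) \<le> 2" unfolding eq using AB diam by auto
    show "1 / 2 \<le> N (mx (\<lambda>i. x i - y i))" if "x \<noteq> y" unfolding eq using AB sep that by auto
  qed (use P tri' scale' C in auto)
  moreover have "card I = 2 * d * d" by (simp add: I_def card_cartesian_product)
  ultimately show ?thesis using card_image[OF inj] by simp
qed

text \<open>Three norms in succession. The entry sum \<open>s\<close> is submultiplicative. Its
  maximum \<open>q\<close> over left translates by \<open>\<Gamma>\<close> is not increased by left
  multiplication with members of \<open>\<Gamma>\<close>, but may exceed 1 on
  \<open>\<Gamma>\<close>. \<open>N\<close> is the operator norm of left multiplication with respect
  to \<open>q\<close>; it is at most 1 on \<open>\<Gamma>\<close> and submultiplicative, as operator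
  norms are.\<close>

lemma exists_invariant_matrix_norm:
  fixes \<Gamma> :: "complex mat set"
  assumes fin: "finite \<Gamma>" and sub: "\<Gamma> \<subseteq> carrier_mat d d" and one: "1\<^sub>m d \<in> \<Gamma>"
    and closed: "\<And>A B. A \<in> \<Gamma> \<Longrightarrow> B \<in> \<Gamma> \<Longrightarrow> A * B \<in> \<Gamma>"
  obtains N :: "complex mat \<Rightarrow> real" where
    "\<And>A B. A \<in> carrier_mat d d \<Longrightarrow> B \<in> carrier_mat d d \<Longrightarrow> N (A + B) \<le> N A + N B"
    "\<And>c A. A \<in> carrier_mat d d \<Longrightarrow> N (c \<cdot>\<^sub>m A) = cmod c * N A"
    "\<And>A B. A \<in> carrier_mat d d \<Longrightarrow> B \<in> carrier_mat d d \<Longrightarrow> N (A * B) \<le> N A * N B"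
    "\<And>A. A \<in> carrier_mat d d \<Longrightarrow> 0 \<le> N A"
    "\<And>A. A \<in> carrier_mat d d \<Longrightarrow> N A = 0 \<Longrightarrow> A = 0\<^sub>m d d"
    "\<And>A. A \<in> \<Gamma> \<Longrightarrow> N A \<le> 1"
proof -
  let ?M = "carrier_mat d d :: complex mat set"
  define s where "s A = (\<Sum>i<d. \<Sum>j<d. cmod (A $$ (i, j)))" for A :: "complex mat"
  have s0: "0 \<le> s A" for A by (simp add: s_def sum_nonneg)
  have s_add: "s (A + B) \<le> s A + s B" if "A \<in> ?M" "B \<in> ?M" for A B
    unfolding s_def sum.distrib[symmetric] using that
    by (intro sum_mono) (auto intro: norm_triangle_ineq)
  have s_scale: "s (c \<cdot>\<^sub>m A) = cmod c * s A" if "A \<in> ?M" for c A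
    using that by (simp add: s_def sum_distrib_left norm_mult)
  have s_mult: "s (A * B) \<le> s A * s B" if A: "A \<in> ?M" and B: "B \<in> ?M" for A B
  proof -
    have "s (A * B) \<le> (\<Sum>i<d. \<Sum>j<d. \<Sum>l<d. cmod (A $$ (i, l)) * cmod (B $$ (l, j)))"
      unfolding s_def
    proof (intro sum_mono)
      fix i j assume "i \<in> {..<d}" "j \<in> {..<d}"
      then show "cmod ((A * B) $$ (i, j)) \<le> (\<Sum>l<d. cmod (A $$ (i, l)) * cmod (B $$ (l, j)))"
        using norm_sum[of "\<lambda>l. A $$ (i, l) * B $$ (l, j)" "{..<d}"]
        by (simp add: index_mult_mat_sum[OF A B] norm_mult)
    qed
    also have "\<dots> = (\<Sum>i<d. \<Sum>l<d. cmod (A $$ (i, l)) * (\<Sum>j<d. cmod (B $$ (l, j))))"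
      by (rule sum.cong[OF refl], subst sum.swap) (simp add: sum_distrib_left)
    also have "\<dots> \<le> (\<Sum>i<d. \<Sum>l<d. cmod (A $$ (i, l)) * s B)"
    proof (intro sum_mono mult_left_mono)
      fix l assume "l \<in> {..<d}"
      then show "(\<Sum>j<d. cmod (B $$ (l, j))) \<le> s B"
        unfolding s_def by (intro member_le_sum[of l _ "\<lambda>l. \<Sum>j<d. cmod (B $$ (l, j))"]) (auto simp: sum_nonneg)
    qed simp
    also have "\<dots> = s A * s B" by (simp add: s_def sum_distrib_right)
    finally show ?thesis .
  qed
  have \<Gamma>M: "T \<in> ?M" if "T \<in> \<Gamma>" for T using sub that by auto
  define q where "q A = Max ((\<lambda>T. s (T * A)) ` \<Gamma>)" for A
  have q_ge: "s (T * A) \<le> q A" if "T \<in> \<Gamma>" for T A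
    unfolding q_def using fin that by (intro Max_ge) auto
  have q_le: "q A \<le> c" if "\<And>T. T \<in> \<Gamma> \<Longrightarrow> s (T * A) \<le> c" for A c
    unfolding q_def using fin one that by (subst Max_le_iff) auto
  have sq: "s A \<le> q A" if "A \<in> ?M" for A using q_ge[OF one, of A] that by simp
  have q0: "0 \<le> q A" for A using q_ge[OF one, of A] s0 order_trans by blast
  have q_add: "q (A + B) \<le> q A + q B" if A: "A \<in> ?M" and B: "B \<in> ?M" for A B
  proof (rule q_le)
    fix T assume T: "T \<in> \<Gamma>"
    have "s (T * (A + B)) = s (T * A + T * B)"
      using mult_add_distrib_mat[OF \<Gamma>M[OF T] A B] by simp
    also have "\<dots> \<le> s (T * A) + s (T * B)" using \<Gamma>M[OF T] A B by (intro s_add) auto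
    also have "\<dots> \<le> q A + q B" by (intro add_mono q_ge T)
    finally show "s (T * (A + B)) \<le> q A + q B" .
  qed
  have q_scale: "q (c \<cdot>\<^sub>m A) \<le> cmod c * q A" if A: "A \<in> ?M" for c A
  proof (rule q_le)
    fix T assume T: "T \<in> \<Gamma>"
    have "s (T * (c \<cdot>\<^sub>m A)) = cmod c * s (T * A)"
      using mult_smult_distrib[OF \<Gamma>M[OF T] A] s_scale[of "T * A" c] \<Gamma>M[OF T] A by simp
    also have "\<dots> \<le> cmod c * q A" by (intro mult_left_mono q_ge T) simp
    finally show "s (T * (c \<cdot>\<^sub>m A)) \<le> cmod c * q A" .
  qed
  have q_mult: "q (A * B) \<le> q A * q B" if A: "A \<in> ?M" and B: "B \<in> ?M" for A B
  proof (rule q_le)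
    fix T assume T: "T \<in> \<Gamma>"
    have "s (T * (A * B)) \<le> s (T * A) * s B"
      using assoc_mult_mat[OF \<Gamma>M[OF T] A B] s_mult[of "T * A" B] \<Gamma>M[OF T] A B by simp
    also have "\<dots> \<le> q A * q B" by (intro mult_mono q_ge T sq B q0 s0)
    finally show "s (T * (A * B)) \<le> q A * q B" .
  qed
  \<comment> \<open>Closure of \<open>\<Gamma>\<close> enters here: \<open>U * T\<close> is again
    one of the elements over which the maximum is taken.\<close>
  have q_\<Gamma>: "q (T * B) \<le> q B" if T: "T \<in> \<Gamma>" and B: "B \<in> ?M" for T B
  proof (rule q_le)
    fix U assume U: "U \<in> \<Gamma>"
    show "s (U * (T * B)) \<le> q B"
      using q_ge[OF closed[OF U T], of B] assoc_mult_mat[OF \<Gamma>M[OF U] \<Gamma>M[OF T] B] by simp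
  qed
  \<comment> \<open>\<open>W A\<close> consists of the admissible constants for left multiplication
    by \<open>A\<close>. It contains \<open>q A\<close> because \<open>q\<close> is
    submultiplicative, so the infimum is meaningful.\<close>
  define W where "W A = {c. 0 \<le> c \<and> (\<forall>B\<in>?M. q (A * B) \<le> c * q B)}" for A
  define N where "N A = Inf (W A)" for A
  have bdd: "bdd_below (W A)" for A unfolding W_def by (rule bdd_belowI[of _ 0]) simp
  have WI: "c \<in> W A" if "0 \<le> c" "\<And>B. B \<in> ?M \<Longrightarrow> q (A * B) \<le> c * q B" for c A
    unfolding W_def using that by simp
  have N_le: "N A \<le> c" if "c \<in> W A" for A c unfolding N_def by (rule cInf_lower[OF that bdd])
  have ne: "W A \<noteq> {}" if "A \<in> ?M" for A
    using WI[of "q A" A] q0 q_mult that by auto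
  have N0: "0 \<le> N A" if "A \<in> ?M" for A
    unfolding N_def by (rule cInf_greatest[OF ne[OF that]]) (simp add: W_def)
  have N_op: "q (A * B) \<le> N A * q B" if A: "A \<in> ?M" and B: "B \<in> ?M" for A B
  proof (cases "q B = 0")
    case True
    obtain c where "c \<in> W A" using ne[OF A] by auto
    then have "q (A * B) \<le> c * q B" using B by (simp add: W_def)
    then show ?thesis using True by simp
  next
    case False
    then have pos: "0 < q B" using q0[of B] by simp
    have "q (A * B) / q B \<le> N A"
      unfolding N_def
    proof (rule cInf_greatest[OF ne[OF A]])
      fix c assume "c \<in> W A"
      then have "q (A * B) \<le> c * q B" using B by (simp add: W_def)
      then show "q (A * B) / q B \<le> c" using pos by (simp add: pos_divide_le_eq)
    qed
    then show ?thesis using pos by (simp add: pos_divide_le_eq)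
  qed
  have N_scale_le: "N (c \<cdot>\<^sub>m A) \<le> cmod c * N A" if A: "A \<in> ?M" for c A
  proof (rule N_le, rule WI)
    fix B assume B: "B \<in> ?M"
    have "q (c \<cdot>\<^sub>m A * B) = q (c \<cdot>\<^sub>m (A * B))" using mult_smult_assoc_mat[OF A B] by simp
    also have "\<dots> \<le> cmod c * q (A * B)" using A B by (intro q_scale) simp
    also have "\<dots> \<le> cmod c * (N A * q B)" by (intro mult_left_mono N_op A B) simp
    finally show "q (c \<cdot>\<^sub>m A * B) \<le> cmod c * N A * q B" by (simp add: mult.assoc)
  qed (use N0 A in simp)
  show thesis
  proof (rule that[of N])
    fix A assume A: "A \<in> ?M"
    show "0 \<le> N A" by (rule N0[OF A])
    show "N (c \<cdot>\<^sub>m A) = cmod c * N A" for c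
    proof (cases "c = 0")
      case True
      then show ?thesis using N_scale_le[OF A, of c] N0[of "c \<cdot>\<^sub>m A"] A by simp
    next
      case False
      have "inverse c \<cdot>\<^sub>m (c \<cdot>\<^sub>m A) = A" using False A by (intro eq_matI) auto
      then have "N A \<le> cmod (inverse c) * N (c \<cdot>\<^sub>m A)"
        using N_scale_le[of "c \<cdot>\<^sub>m A" "inverse c"] A by simp
      then have "cmod c * N A \<le> N (c \<cdot>\<^sub>m A)"
        unfolding norm_inverse using False by (simp add: field_simps)
      then show ?thesis using N_scale_le[OF A, of c] by simp
    qed
    show "A = 0\<^sub>m d d" if "N A = 0"
    proof (rule eq_matI)
      \<comment> \<open>The operator norm is tested on the identity matrix:
        \<open>s A \<le> q A\<close>, and \<open>q A\<close> is at most \<open>N A\<close> times the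
        value of \<open>q\<close> at the identity.\<close>
      have "s A \<le> 0" using sq[OF A] N_op[OF A, of "1\<^sub>m d"] that A by simp
      then have "s A = 0" using s0[of A] by simp
      then have "\<forall>i<d. \<forall>j<d. A $$ (i, j) = 0"
        by (simp add: s_def sum_nonneg_eq_0_iff sum_nonneg)
      then show "A $$ (i, j) = 0\<^sub>m d d $$ (i, j)" if "i < dim_row (0\<^sub>m d d)" "j < dim_col (0\<^sub>m d d)" for i j
        using that by simp
    qed (use A in auto)
    fix B assume B: "B \<in> ?M"
    show "N (A + B) \<le> N A + N B"
    proof (rule N_le, rule WI)
      fix D assume D: "D \<in> ?M"
      have "q ((A + B) * D) = q (A * D + B * D)" using add_mult_distrib_mat[OF A B D] by simp
      also have "\<dots> \<le> q (A * D) + q (B * D)" using A B D by (intro q_add) auto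
      also have "\<dots> \<le> N A * q D + N B * q D" by (intro add_mono N_op A B D)
      finally show "q ((A + B) * D) \<le> (N A + N B) * q D" by (simp add: distrib_right)
    qed (use N0 A B in simp)
    show "N (A * B) \<le> N A * N B"
    proof (rule N_le, rule WI)
      fix D assume D: "D \<in> ?M"
      have "q (A * B * D) = q (A * (B * D))" using assoc_mult_mat[OF A B D] by simp
      also have "\<dots> \<le> N A * q (B * D)" using B D by (intro N_op A) simp
      also have "\<dots> \<le> N A * (N B * q D)" by (intro mult_left_mono N_op N0 A B D)
      finally show "q (A * B * D) \<le> N A * N B * q D" by (simp add: mult.assoc)
    qed (use N0 A B in simp)
  next
    fix A assume "A \<in> \<Gamma>"
    then show "N A \<le> 1" by (intro N_le WI) (auto intro: q_\<Gamma>)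
  qed
qed

section \<open>Small quotients and Abelian quotients\<close>

text \<open>Since this set is a subgroup, commutation with \<open>a\<close> need only be checked on
  generators.\<close>

lemma (in group_hom) centralizer_preimage_subgroup:
  assumes a: "a \<in> carrier H"
  shows "subgroup {y \<in> carrier G. h y \<otimes>\<^bsub>H\<^esub> a = a \<otimes>\<^bsub>H\<^esub> h y} G"
proof (rule G.subgroupI)
  fix y assume "y \<in> {y \<in> carrier G. h y \<otimes>\<^bsub>H\<^esub> a = a \<otimes>\<^bsub>H\<^esub> h y}"
  then have y: "y \<in> carrier G" "h y \<otimes>\<^bsub>H\<^esub> a = a \<otimes>\<^bsub>H\<^esub> h y" by auto
  have hy: "h y \<in> carrier H" using y by simp
  have "inv\<^bsub>H\<^esub> h y \<otimes>\<^bsub>H\<^esub> a = inv\<^bsub>H\<^esub> h y \<otimes>\<^bsub>H\<^esub> (a \<otimes>\<^bsub>H\<^esub> h y) \<otimes>\<^bsub>H\<^esub> inv\<^bsub>H\<^esub> h y"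
    using a hy by (simp add: H.m_assoc)
  also have "\<dots> = a \<otimes>\<^bsub>H\<^esub> inv\<^bsub>H\<^esub> h y"
    using a hy by (simp add: y(2)[symmetric] H.m_assoc[symmetric])
  finally show "inv y \<in> {y \<in> carrier G. h y \<otimes>\<^bsub>H\<^esub> a = a \<otimes>\<^bsub>H\<^esub> h y}" using y by simp
next
  fix y z assume "y \<in> {y \<in> carrier G. h y \<otimes>\<^bsub>H\<^esub> a = a \<otimes>\<^bsub>H\<^esub> h y}" "z \<in> {y \<in> carrier G. h y \<otimes>\<^bsub>H\<^esub> a = a \<otimes>\<^bsub>H\<^esub> h y}"
  then have yz: "y \<in> carrier G" "h y \<otimes>\<^bsub>H\<^esub> a = a \<otimes>\<^bsub>H\<^esub> h y" "z \<in> carrier G" "h z \<otimes>\<^bsub>H\<^esub> a = a \<otimes>\<^bsub>H\<^esub> h z" by auto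
  have "h y \<otimes>\<^bsub>H\<^esub> h z \<otimes>\<^bsub>H\<^esub> a = h y \<otimes>\<^bsub>H\<^esub> a \<otimes>\<^bsub>H\<^esub> h z"
    using a yz(1,3) by (simp add: H.m_assoc yz(4))
  also have "\<dots> = a \<otimes>\<^bsub>H\<^esub> (h y \<otimes>\<^bsub>H\<^esub> h z)"
    unfolding yz(2) using a yz(1,3) by (simp add: H.m_assoc)
  finally show "y \<otimes> z \<in> {y \<in> carrier G. h y \<otimes>\<^bsub>H\<^esub> a = a \<otimes>\<^bsub>H\<^esub> h y}" using yz by simp
qed (use a in auto)

text \<open>The centre of the image, pulled back as an intersection of preimages of centralizers;
  conjugation does not change \<open>h c\<close>. The set is formed in \<open>G\<close> so that
  maximality of a normal subgroup of \<open>G\<close> applies to it.\<close>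

lemma (in group_hom) center_preimage_normal:
  "{x \<in> carrier G. \<forall>y\<in>carrier G. h x \<otimes>\<^bsub>H\<^esub> h y = h y \<otimes>\<^bsub>H\<^esub> h x} \<lhd> G" (is "?C \<lhd> G")
  unfolding G.normal_inv_iff
proof (intro conjI ballI)
  have "?C = (\<Inter>y\<in>carrier G. {x \<in> carrier G. h x \<otimes>\<^bsub>H\<^esub> h y = h y \<otimes>\<^bsub>H\<^esub> h x})"
    using G.one_closed by blast
  also have "subgroup \<dots> G"
    by (rule G.subgroups_Inter) (use G.one_closed centralizer_preimage_subgroup in auto)
  finally show "subgroup ?C G" .
next
  fix x c assume x: "x \<in> carrier G" and c: "c \<in> ?C"
  have "h (x \<otimes> c \<otimes> inv x) = h c \<otimes>\<^bsub>H\<^esub> h x \<otimes>\<^bsub>H\<^esub> inv\<^bsub>H\<^esub> h x" using x c by simp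
  also have "\<dots> = h c \<otimes>\<^bsub>H\<^esub> (h x \<otimes>\<^bsub>H\<^esub> inv\<^bsub>H\<^esub> h x)" using x c by (intro H.m_assoc) auto
  also have "\<dots> = h c" using x c by simp
  finally show "x \<otimes> c \<otimes> inv x \<in> ?C" using x c by simp
qed

lemma (in group) maximal_normal_subgroup_exists:
  assumes fin: "finite (carrier G)" and K: "K \<lhd> G" "K \<noteq> carrier G"
  obtains M where "M \<lhd> G" "M \<noteq> carrier G" "K \<subseteq> M"
    "\<And>H. H \<lhd> G \<Longrightarrow> M \<subseteq> H \<Longrightarrow> H \<noteq> M \<Longrightarrow> H = carrier G"
proof -
  define F where "F = {H. H \<lhd> G \<and> K \<subseteq> H \<and> H \<noteq> carrier G}"
  have "F \<subseteq> Pow (carrier G)" unfolding F_def by (auto simp: normal_inv_iff dest: subgroup.subset)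
  then have "finite F" using fin by (meson finite_Pow_iff finite_subset)
  moreover have "K \<in> F" using K by (simp add: F_def)
  ultimately obtain M where M: "M \<in> F" "\<And>H. H \<in> F \<Longrightarrow> M \<subseteq> H \<Longrightarrow> M = H"
    using finite_has_maximal[of F] by auto
  show thesis
  proof (rule that)
    fix H assume "H \<lhd> G" "M \<subseteq> H" "H \<noteq> M"
    then show "H = carrier G" using M unfolding F_def by auto
  qed (use M in \<open>auto simp: F_def\<close>)
qed

text \<open>For a generator \<open>s\<close>, the factor \<open>2 * \<delta> s < 1\<close> makes the
  commutator with \<open>g\<close> smaller than \<open>g\<close>. If \<open>g\<close> is a smallest
  generator outside \<open>M\<close>, the commutator has to lie in \<open>M\<close>, so
  \<open>g\<close> is central modulo \<open>M\<close>.\<close>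

lemma (in group) comm_quotient_of_small_generators:
  fixes \<delta> :: "'a \<Rightarrow> real"
  assumes fin: "finite (carrier G)" and K: "K \<lhd> G" "K \<noteq> carrier G"
    and pos: "\<And>g. g \<in> carrier G \<Longrightarrow> g \<notin> K \<Longrightarrow> 0 < \<delta> g"
    and comm: "\<And>g h. g \<in> carrier G \<Longrightarrow> h \<in> carrier G \<Longrightarrow>
      \<delta> (g \<otimes> h \<otimes> inv g \<otimes> inv h) \<le> 2 * \<delta> g * \<delta> h"
    and gen: "generate G {g \<in> carrier G. \<delta> g < 1 / 2} = carrier G"
  shows "\<exists>M. M \<lhd> G \<and> M \<noteq> carrier G \<and> comm_group (G Mod M)"
proof -
  define S where "S = {g \<in> carrier G. \<delta> g < 1 / 2}"
  obtain M where M: "M \<lhd> G" "M \<noteq> carrier G" "K \<subseteq> M"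
    and maximal: "\<And>H. H \<lhd> G \<Longrightarrow> M \<subseteq> H \<Longrightarrow> H \<noteq> M \<Longrightarrow> H = carrier G"
    using maximal_normal_subgroup_exists[OF fin K] by blast
  interpret M: normal M G by fact
  interpret Q: group "G Mod M" by (rule M.factorgroup_is_group)
  interpret \<pi>: group_hom G "G Mod M" "\<lambda>g. M #> g"
    by (intro group_hom.intro group_hom_axioms.intro is_group Q.is_group M.r_coset_hom_Mod)
  have "\<not> S \<subseteq> M"
  proof
    assume "S \<subseteq> M"
    then have "generate G S \<subseteq> M" by (rule generate_subgroup_incl[OF _ M.subgroup_axioms])
    then have "carrier G \<subseteq> M" by (simp only: S_def gen)
    then show False using M(2) M.subset by auto
  qed
  moreover have "finite (S - M)" using fin by (simp add: S_def)
  ultimately obtain g where g: "g \<in> S - M" and least: "\<And>h. h \<in> S - M \<Longrightarrow> \<delta> g \<le> \<delta> h"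
    using ex_min_if_finite[of "\<delta> ` (S - M)"] by (metis (no_types, lifting) Diff_eq_empty_iff finite_imageI image_iff image_is_empty not_le)
  \<comment> \<open>\<open>\<delta> g\<close> is strictly positive because \<open>g\<close> lies
    outside \<open>M\<close> and hence outside \<open>K\<close>; the strict decrease below relies on
    this.\<close>
  have gc: "g \<in> carrier G" and \<delta>g: "0 < \<delta> g" "\<delta> g < 1 / 2" using g pos M(3) by (auto simp: S_def)
  have comm_S: "(M #> s) \<otimes>\<^bsub>G Mod M\<^esub> (M #> g) = (M #> g) \<otimes>\<^bsub>G Mod M\<^esub> (M #> s)" if s: "s \<in> S" for s
  proof -
    have sc: "s \<in> carrier G" and \<delta>s: "\<delta> s < 1 / 2" using s by (auto simp: S_def)
    define k where "k = g \<otimes> s \<otimes> inv g \<otimes> inv s"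
    have kc: "k \<in> carrier G" using gc sc by (simp add: k_def)
    have "\<delta> k \<le> 2 * \<delta> g * \<delta> s" unfolding k_def by (rule comm[OF gc sc])
    also have "\<dots> < \<delta> g" using \<delta>g \<delta>s by (simp add: mult_less_cancel_left1 mult.commute mult.left_commute)
    \<comment> \<open>Since \<open>\<delta> k < \<delta> g < 1 / 2\<close>, the commutator is again
      in \<open>S\<close>; outside \<open>M\<close> it would contradict the choice of
      \<open>g\<close>.\<close>
    finally have "k \<in> M" using least[of k] kc \<delta>g by (auto simp: S_def)
    have "g \<otimes> s = k \<otimes> (s \<otimes> g)" using gc sc by (simp add: k_def m_assoc inv_solve_left')
    then have "M #> (g \<otimes> s) = M #> (s \<otimes> g)"
      using gc sc kc coset_mult_assoc[OF M.subset kc] coset_join2[OF kc M.subgroup_axioms \<open>k \<in> M\<close>]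
      by (metis m_closed)
    then show ?thesis using gc sc by simp
  qed
  let ?Z = "{y \<in> carrier G. (M #> y) \<otimes>\<^bsub>G Mod M\<^esub> (M #> g) = (M #> g) \<otimes>\<^bsub>G Mod M\<^esub> (M #> y)}"
  have "generate G S \<subseteq> ?Z"
    by (rule generate_subgroup_incl[OF _ \<pi>.centralizer_preimage_subgroup])
      (use comm_S gc in \<open>auto simp: S_def\<close>)
  then have comm_G: "(M #> y) \<otimes>\<^bsub>G Mod M\<^esub> (M #> g) = (M #> g) \<otimes>\<^bsub>G Mod M\<^esub> (M #> y)" if "y \<in> carrier G" for y
    using gen that by (auto simp: S_def)
  let ?C = "{x \<in> carrier G. \<forall>y\<in>carrier G. (M #> x) \<otimes>\<^bsub>G Mod M\<^esub> (M #> y) = (M #> y) \<otimes>\<^bsub>G Mod M\<^esub> (M #> x)}"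
  have "M \<subseteq> ?C"
  proof
    fix x assume x: "x \<in> M"
    then have 1: "M #> x = \<one>\<^bsub>G Mod M\<^esub>"
      using coset_join2[OF _ M.subgroup_axioms] M.mem_carrier by simp
    have "(M #> x) \<otimes>\<^bsub>G Mod M\<^esub> (M #> y) = (M #> y) \<otimes>\<^bsub>G Mod M\<^esub> (M #> x)" if "y \<in> carrier G" for y
      unfolding 1 Q.l_one[OF \<pi>.hom_closed[OF that]] Q.r_one[OF \<pi>.hom_closed[OF that]] ..
    then show "x \<in> ?C" using M.mem_carrier[OF x] by blast
  qed
  moreover have "g \<in> ?C" using gc comm_G by auto
  \<comment> \<open>\<open>?C\<close> is normal and contains \<open>M\<close>, strictly so because
    of \<open>g\<close>; maximality of \<open>M\<close> leaves only the whole group.\<close>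
  ultimately have "?C = carrier G" using g by (intro maximal \<pi>.center_preimage_normal) auto
  then have "comm_group (G Mod M)"
    by (intro Q.group_comm_groupI) (auto simp: FactGroup_def RCOSETS_def)
  then show ?thesis using M by blast
qed

section \<open>The dichotomy for a non-trivial representation\<close>

text \<open>If \<open>H\<close> is proper, \<open>G Mod H\<close> is the small quotient. If
  \<open>H\<close> is everything, \<open>comm_quotient_of_small_generators\<close> applies with the
  kernel of \<open>\<rho>\<close> as \<open>K\<close>: definiteness of \<open>N\<close> makes
  \<open>\<delta>\<close> positive outside the kernel.\<close>

lemma comm_quotient_or_small_quotient:
  assumes G: "group G" and fin: "finite (carrier G)"
    and nt: "nontrivial_representation G d \<rho>"
  shows "\<exists>H. H \<lhd> G \<and> H \<noteq> carrier G \<and> (comm_group (G Mod H) \<or> order (G Mod H) \<le> 6 ^ (2 * d * d))"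
proof -
  interpret group G by fact
  let ?M = "carrier_mat d d :: complex mat set"
  have rep: "is_representation G d \<rho>" using nt unfolding nontrivial_representation_def by simp
  have \<rho>: "\<rho> x \<in> ?M" if "x \<in> carrier G" for x
    using rep that unfolding is_representation_iff[OF G] by simp
  have mult: "\<rho> (x \<otimes>\<^bsub>G\<^esub> y) = \<rho> x * \<rho> y" if "x \<in> carrier G" "y \<in> carrier G" for x y
    using rep that unfolding is_representation_iff[OF G] by simp
  have one: "\<rho> \<one>\<^bsub>G\<^esub> = 1\<^sub>m d"
    using rep unfolding is_representation_iff[OF G] by simp
  have I: "1\<^sub>m d \<in> ?M" by simp
  obtain N where
        tri: "\<And>A B. A \<in> ?M \<Longrightarrow> B \<in> ?M \<Longrightarrow> N (A + B) \<le> N A + N B"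
    and scale: "\<And>c A. A \<in> ?M \<Longrightarrow> N (c \<cdot>\<^sub>m A) = cmod c * N A"
    and submult: "\<And>A B. A \<in> ?M \<Longrightarrow> B \<in> ?M \<Longrightarrow> N (A * B) \<le> N A * N B"
    and nonneg: "\<And>A. A \<in> ?M \<Longrightarrow> 0 \<le> N A"
    and definite: "\<And>A. A \<in> ?M \<Longrightarrow> N A = 0 \<Longrightarrow> A = 0\<^sub>m d d"
    and "\<And>A. A \<in> \<rho> ` carrier G \<Longrightarrow> N A \<le> 1"
  proof (rule exists_invariant_matrix_norm[of "\<rho> ` carrier G" d])
    show "1\<^sub>m d \<in> \<rho> ` carrier G" using one by (metis image_eqI one_closed)
    show "A * B \<in> \<rho> ` carrier G" if "A \<in> \<rho> ` carrier G" "B \<in> \<rho> ` carrier G" for A B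
      using that by (auto simp flip: mult)
  qed (use fin \<rho> in auto)
  then have unit: "N (\<rho> x) \<le> 1" if "x \<in> carrier G" for x using that by auto
  have diff: "N (A - B) \<le> N A + N B" if "A \<in> ?M" "B \<in> ?M" for A B
  proof -
    have "A - B = A + (- 1) \<cdot>\<^sub>m B" using that by (intro eq_matI) auto
    then show ?thesis using tri[of A "(- 1) \<cdot>\<^sub>m B"] scale[of B "- 1"] that by simp
  qed
  have right: "N (A * \<rho> x) \<le> N A" if "A \<in> ?M" "x \<in> carrier G" for A x
    using submult[OF that(1) \<rho>[OF that(2)]] mult_left_mono[OF unit[OF that(2)] nonneg[OF that(1)]] by simp
  have left: "N (\<rho> x * A) \<le> N A" if "A \<in> ?M" "x \<in> carrier G" for A x
    using submult[OF \<rho>[OF that(2)] that(1)] mult_right_mono[OF unit[OF that(2)] nonneg[OF that(1)]] by simp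
  define \<delta> where "\<delta> g = N (\<rho> g - 1\<^sub>m d)" for g
  define S where "S = {g \<in> carrier G. \<delta> g < 1 / 2}"
  define H where "H = generate G S"
  \<comment> \<open>Multiplication by \<open>\<rho> x\<close> on either side does not increase
    \<open>N\<close>, so conjugation does not increase \<open>\<delta>\<close> and maps the
    generating set \<open>S\<close> into itself.\<close>
  have "H \<lhd> G"
    unfolding H_def
  proof (rule normal_generateI)
    fix g x assume "g \<in> S" and x: "x \<in> carrier G"
    then have g: "g \<in> carrier G" "\<delta> g < 1 / 2" by (auto simp: S_def)
    have ix: "inv\<^bsub>G\<^esub> x \<in> carrier G" using x by simp
    have D: "\<rho> g - 1\<^sub>m d \<in> ?M" by (intro minus_carrier_mat I)
    have "\<rho> x * (\<rho> g - 1\<^sub>m d) = \<rho> x * \<rho> g - \<rho> x"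
      using mult_minus_distrib_mat[OF \<rho>[OF x] \<rho>[OF g(1)] I] \<rho>[OF x] by simp
    moreover have "(\<rho> x * \<rho> g - \<rho> x) * \<rho> (inv\<^bsub>G\<^esub> x) = \<rho> x * \<rho> g * \<rho> (inv\<^bsub>G\<^esub> x) - \<rho> x * \<rho> (inv\<^bsub>G\<^esub> x)"
      using mult_carrier_mat[OF \<rho>[OF x] \<rho>[OF g(1)]] by (rule minus_mult_distrib_mat[OF _ \<rho>[OF x] \<rho>[OF ix]])
    moreover have "\<rho> (x \<otimes>\<^bsub>G\<^esub> g \<otimes>\<^bsub>G\<^esub> inv\<^bsub>G\<^esub> x) = \<rho> x * \<rho> g * \<rho> (inv\<^bsub>G\<^esub> x)"
      using x g by (simp only: mult m_closed ix)
    moreover have "\<rho> x * \<rho> (inv\<^bsub>G\<^esub> x) = 1\<^sub>m d" using x by (simp add: one flip: mult)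
    ultimately have "\<rho> (x \<otimes>\<^bsub>G\<^esub> g \<otimes>\<^bsub>G\<^esub> inv\<^bsub>G\<^esub> x) - 1\<^sub>m d = \<rho> x * (\<rho> g - 1\<^sub>m d) * \<rho> (inv\<^bsub>G\<^esub> x)" by simp
    then have "\<delta> (x \<otimes>\<^bsub>G\<^esub> g \<otimes>\<^bsub>G\<^esub> inv\<^bsub>G\<^esub> x) \<le> N (\<rho> x * (\<rho> g - 1\<^sub>m d))"
      unfolding \<delta>_def using right[OF mult_carrier_mat[OF \<rho>[OF x] D] ix] by simp
    also have "\<dots> \<le> \<delta> g" unfolding \<delta>_def by (rule left[OF D x])
    finally show "x \<otimes>\<^bsub>G\<^esub> g \<otimes>\<^bsub>G\<^esub> inv\<^bsub>G\<^esub> x \<in> S" using g x by (simp add: S_def)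
  qed (auto simp: S_def)
  interpret H: normal H G by fact
  show ?thesis
  proof (cases "H = carrier G")
    case False
    define rep where "rep U = (SOME x. x \<in> U)" for U :: "'a set"
    have rep: "rep U \<in> carrier G" "U = H #>\<^bsub>G\<^esub> rep U" if U: "U \<in> rcosets\<^bsub>G\<^esub> H" for U
    proof -
      obtain x where x: "x \<in> carrier G" "U = H #>\<^bsub>G\<^esub> x" using U by (auto simp: RCOSETS_def)
      have "x \<in> U" using x rcos_self[OF x(1) H.subgroup_axioms] by simp
      then have "rep U \<in> U" unfolding rep_def by (rule someI)
      then show "rep U \<in> carrier G" "U = H #>\<^bsub>G\<^esub> rep U"
        using x repr_independence[OF _ x(1) H.subgroup_axioms] r_coset_subset_G[OF H.subset x(1)] by auto
    qed
    \<comment> \<open>For representatives \<open>x\<close> and \<open>y\<close>, the matrix of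
      \<open>x\<close> times the inverse of \<open>y\<close>, minus the identity, is
      \<open>\<rho> x - \<rho> y\<close> times the matrix of the inverse of \<open>y\<close>. If its
      norm were below \<open>1 / 2\<close>, the quotient of \<open>x\<close> and \<open>y\<close>
      would lie in \<open>S\<close> and the cosets would coincide.\<close>
    have sep: "1 / 2 \<le> N (\<rho> (rep U) - \<rho> (rep V))"
      if UV: "U \<in> rcosets\<^bsub>G\<^esub> H" "V \<in> rcosets\<^bsub>G\<^esub> H" "U \<noteq> V" for U V
    proof (rule ccontr)
      assume lt: "\<not> 1 / 2 \<le> N (\<rho> (rep U) - \<rho> (rep V))"
      let ?x = "rep U" and ?y = "rep V"
      have x: "?x \<in> carrier G" and y: "?y \<in> carrier G" using rep UV by auto
      have iy: "inv\<^bsub>G\<^esub> ?y \<in> carrier G" using y by simp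
      have "\<rho> (?x \<otimes>\<^bsub>G\<^esub> inv\<^bsub>G\<^esub> ?y) - 1\<^sub>m d = (\<rho> ?x - \<rho> ?y) * \<rho> (inv\<^bsub>G\<^esub> ?y)"
        unfolding minus_mult_distrib_mat[OF \<rho>[OF x] \<rho>[OF y] \<rho>[OF iy]]
        using x y by (simp add: one flip: mult)
      then have "\<delta> (?x \<otimes>\<^bsub>G\<^esub> inv\<^bsub>G\<^esub> ?y) \<le> N (\<rho> ?x - \<rho> ?y)"
        unfolding \<delta>_def using right[OF minus_carrier_mat[OF \<rho>[OF y]] iy, of "\<rho> ?x"] by simp
      then have "?x \<otimes>\<^bsub>G\<^esub> inv\<^bsub>G\<^esub> ?y \<in> H" unfolding H_def using lt x y by (intro generate.incl) (simp add: S_def)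
      moreover have "?x \<otimes>\<^bsub>G\<^esub> inv\<^bsub>G\<^esub> ?y \<otimes>\<^bsub>G\<^esub> ?y = ?x" using x y by (simp add: m_assoc)
      ultimately have "?x \<in> H #>\<^bsub>G\<^esub> ?y" unfolding r_coset_def by force
      then have "H #>\<^bsub>G\<^esub> ?y = H #>\<^bsub>G\<^esub> ?x" by (rule repr_independence[OF _ y H.subgroup_axioms])
      then show False using rep UV by auto
    qed
    have N0: "N (0\<^sub>m d d) = 0" using scale[of "0\<^sub>m d d" 0] by simp
    have inj: "inj_on (\<lambda>U. \<rho> (rep U)) (rcosets\<^bsub>G\<^esub> H)"
    proof (rule inj_onI, rule ccontr)
      fix U V assume UV: "U \<in> rcosets\<^bsub>G\<^esub> H" "V \<in> rcosets\<^bsub>G\<^esub> H" "\<rho> (rep U) = \<rho> (rep V)" "U \<noteq> V"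
      have "\<rho> (rep U) - \<rho> (rep V) = 0\<^sub>m d d" using UV(3) \<rho>[OF rep(1)[OF UV(2)]] by auto
      then show False using sep[OF UV(1,2,4)] N0 by simp
    qed
    have "card ((\<lambda>U. \<rho> (rep U)) ` (rcosets\<^bsub>G\<^esub> H)) \<le> 6 ^ (2 * d * d)"
    proof (rule separated_matrices_card_bound[OF _ _ tri scale])
      fix A B assume "A \<in> (\<lambda>U. \<rho> (rep U)) ` (rcosets\<^bsub>G\<^esub> H)" "B \<in> (\<lambda>U. \<rho> (rep U)) ` (rcosets\<^bsub>G\<^esub> H)"
      then obtain U V where UV: "U \<in> rcosets\<^bsub>G\<^esub> H" "V \<in> rcosets\<^bsub>G\<^esub> H" "A = \<rho> (rep U)" "B = \<rho> (rep V)" by auto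
      show "N (A - B) \<le> 2"
        using diff[OF \<rho> \<rho>, OF rep(1) rep(1), OF UV(1,2)] unit[OF rep(1)[OF UV(1)]] unit[OF rep(1)[OF UV(2)]]
        unfolding UV(3,4) by simp
      show "1 / 2 \<le> N (A - B)" if "A \<noteq> B" using sep UV that by auto
    qed (use fin \<rho> rep in \<open>auto simp: RCOSETS_def\<close>)
    then have "order (G Mod H) \<le> 6 ^ (2 * d * d)"
      unfolding card_image[OF inj] by (simp add: order_def FactGroup_def)
    then show ?thesis using \<open>H \<lhd> G\<close> False by blast
  next
    case True
    interpret \<phi>: group_hom G "complex_GL d" \<rho>
      using rep group_complex_GL by (intro group_hom.intro group_hom_axioms.intro is_group)
        (auto simp: is_representation_def)
    let ?K = "kernel G (complex_GL d) \<rho>"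
    have "\<exists>M. M \<lhd> G \<and> M \<noteq> carrier G \<and> comm_group (G Mod M)"
    proof (rule comm_quotient_of_small_generators[OF fin \<phi>.normal_kernel, of \<delta>])
      show "?K \<noteq> carrier G" using nt unfolding nontrivial_representation_def kernel_def one_complex_GL by auto
      show "generate G {g \<in> carrier G. \<delta> g < 1 / 2} = carrier G" using True unfolding H_def S_def .
    next
      fix g assume g: "g \<in> carrier G" "g \<notin> ?K"
      have D: "\<rho> g - 1\<^sub>m d \<in> ?M" by (intro minus_carrier_mat I)
      have "\<delta> g \<noteq> 0"
      proof
        assume "\<delta> g = 0"
        then have "\<rho> g - 1\<^sub>m d = 0\<^sub>m d d" using definite[OF D] by (simp add: \<delta>_def)
        then have "\<rho> g - 1\<^sub>m d + 1\<^sub>m d = 1\<^sub>m d" by simp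
        moreover have "\<rho> g - 1\<^sub>m d + 1\<^sub>m d = \<rho> g" using \<rho>[OF g(1)] by (intro eq_matI) auto
        ultimately show False using g by (simp add: kernel_def one_complex_GL)
      qed
      then show "0 < \<delta> g" using nonneg[OF D] by (simp add: \<delta>_def)
    next
      fix g h assume g: "g \<in> carrier G" and h: "h \<in> carrier G"
      define A where "A = \<rho> g - 1\<^sub>m d"
      define B where "B = \<rho> h - 1\<^sub>m d"
      have AB: "A \<in> ?M" "B \<in> ?M" unfolding A_def B_def by (intro minus_carrier_mat I)+
      have ig: "inv\<^bsub>G\<^esub> g \<in> carrier G" and ih: "inv\<^bsub>G\<^esub> h \<in> carrier G" using g h by auto
      have 1: "A * B = \<rho> g * \<rho> h - \<rho> g - B"
        unfolding A_def using minus_mult_distrib_mat[OF \<rho>[OF g] I AB(2)] AB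
          mult_minus_distrib_mat[OF \<rho>[OF g] \<rho>[OF h] I] \<rho>[OF g] \<rho>[OF h]
        by (intro eq_matI) (auto simp: B_def)
      have 2: "B * A = \<rho> h * \<rho> g - \<rho> h - A"
        unfolding B_def using minus_mult_distrib_mat[OF \<rho>[OF h] I AB(1)] AB
          mult_minus_distrib_mat[OF \<rho>[OF h] \<rho>[OF g] I] \<rho>[OF g] \<rho>[OF h]
        by (intro eq_matI) (auto simp: A_def)
      \<comment> \<open>Subtracting the identity from both matrices does not change their
        commutator. Multiplication by the inverse of \<open>\<rho> h * \<rho> g\<close> then turns
        it into the image of the group commutator minus the identity.\<close>
      have "A * B - B * A = \<rho> g * \<rho> h - \<rho> h * \<rho> g"
        unfolding 1 2 unfolding A_def B_def using \<rho>[OF g] \<rho>[OF h] by (intro eq_matI) auto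
      then have comm: "A * B - B * A = \<rho> (g \<otimes>\<^bsub>G\<^esub> h) - \<rho> (h \<otimes>\<^bsub>G\<^esub> g)" using g h by (simp add: mult del: \<phi>.hom_mult)
      have gh: "g \<otimes>\<^bsub>G\<^esub> h \<in> carrier G" "h \<otimes>\<^bsub>G\<^esub> g \<in> carrier G" using g h by auto
      have "(A * B - B * A) * \<rho> (inv\<^bsub>G\<^esub> (h \<otimes>\<^bsub>G\<^esub> g)) = \<rho> (g \<otimes>\<^bsub>G\<^esub> h \<otimes>\<^bsub>G\<^esub> inv\<^bsub>G\<^esub> (h \<otimes>\<^bsub>G\<^esub> g)) - 1\<^sub>m d"
        unfolding comm minus_mult_distrib_mat[OF \<rho>[OF gh(1)] \<rho>[OF gh(2)] \<rho>[OF inv_closed[OF gh(2)]]]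
        using gh by (simp add: one del: \<phi>.hom_mult \<phi>.hom_inv \<phi>.hom_one flip: mult)
      moreover have "g \<otimes>\<^bsub>G\<^esub> h \<otimes>\<^bsub>G\<^esub> inv\<^bsub>G\<^esub> (h \<otimes>\<^bsub>G\<^esub> g) = g \<otimes>\<^bsub>G\<^esub> h \<otimes>\<^bsub>G\<^esub> inv\<^bsub>G\<^esub> g \<otimes>\<^bsub>G\<^esub> inv\<^bsub>G\<^esub> h"
        using g h by (simp add: inv_mult_group m_assoc)
      ultimately have "\<delta> (g \<otimes>\<^bsub>G\<^esub> h \<otimes>\<^bsub>G\<^esub> inv\<^bsub>G\<^esub> g \<otimes>\<^bsub>G\<^esub> inv\<^bsub>G\<^esub> h) = N ((A * B - B * A) * \<rho> (inv\<^bsub>G\<^esub> (h \<otimes>\<^bsub>G\<^esub> g)))"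
        by (simp add: \<delta>_def)
      also have "\<dots> \<le> N (A * B - B * A)"
        using AB gh by (intro right minus_carrier_mat mult_carrier_mat inv_closed)
      also have "\<dots> \<le> N (A * B) + N (B * A)" using AB by (intro diff) auto
      also have "\<dots> \<le> N A * N B + N B * N A" by (intro add_mono submult AB)
      also have "\<dots> = 2 * \<delta> g * \<delta> h" by (simp add: A_def B_def \<delta>_def)
      finally show "\<delta> (g \<otimes>\<^bsub>G\<^esub> h \<otimes>\<^bsub>G\<^esub> inv\<^bsub>G\<^esub> g \<otimes>\<^bsub>G\<^esub> inv\<^bsub>G\<^esub> h) \<le> 2 * \<delta> g * \<delta> h" .
    qed
    then show ?thesis by blast
  qed
qed

section \<open>Numerical estimate and conclusion\<close>

text \<open>The source of the bound in the theorem: the hypothesis amounts to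
  \<open>4 * d * d < ln m\<close>, while \<open>6 ^ (2 * d * d) = 36 ^ (d * d)\<close> and
  \<open>36 \<le> exp 4\<close>.\<close>

lemma six_power_lt_of_dim_lt:
  assumes "m > 0" "real d < sqrt (ln (real m)) / 2"
  shows "6 ^ (2 * d * d) < m"
proof -
  have "2 * real d < sqrt (ln (real m))" using assms(2) by simp
  then have "(2 * real d)\<^sup>2 < (sqrt (ln (real m)))\<^sup>2" by (intro power_strict_mono) auto
  then have lt: "4 * real (d * d) < ln (real m)"
    using assms(1) by (simp add: power2_eq_square)
  \<comment> \<open>\<open>5 / 2 = 1 + 1 + 1 / 2\<close> is the quadratic Taylor bound at 1; its
    fourth power is about 39 and exceeds 36.\<close>
  have "(5 / 2 :: real) \<le> exp 1"
    using exp_lower_Taylor_quadratic[of "1 :: real"] by simp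
  then have "(5 / 2 :: real) ^ 4 \<le> exp 1 ^ 4" by (intro power_mono) auto
  then have e4: "(36 :: real) \<le> exp 4" by (simp add: power4_eq_xxxx exp_of_nat_mult[of 4 "1 :: real", simplified])
  have "real (6 ^ (2 * d * d)) = 36 ^ (d * d)" by (simp add: power_mult mult.assoc)
  also have "\<dots> \<le> exp 4 ^ (d * d)" using e4 by (intro power_mono) auto
  also have "\<dots> = exp (4 * real (d * d))" by (simp add: exp_of_nat_mult[symmetric] mult.commute)
  also have "\<dots> < exp (ln (real m))" using lt by simp
  also have "\<dots> = real m" using assms(1) by simp
  finally show ?thesis by linarith
qed

lemma order_nontrivial_quotient:
  assumes G: "group G" and fin: "finite (carrier G)" and H: "H \<lhd> G" "H \<noteq> carrier G"
  shows "order (G Mod H) \<noteq> 1" "finite (carrier (G Mod H))"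
proof -
  interpret group G by fact
  interpret H: normal H G by fact
  show "finite (carrier (G Mod H))" using fin by (simp add: FactGroup_def RCOSETS_def)
  show "order (G Mod H) \<noteq> 1"
  proof
    assume "order (G Mod H) = 1"
    then obtain U where U: "rcosets\<^bsub>G\<^esub> H = {U}" by (auto simp: order_def FactGroup_def card_1_singleton_iff)
    have "x \<in> H" if x: "x \<in> carrier G" for x
    proof -
      have "H #>\<^bsub>G\<^esub> x = H #>\<^bsub>G\<^esub> \<one>\<^bsub>G\<^esub>" using U rcosetsI[OF H.subset x] rcosetsI[OF H.subset one_closed] by simp
      then show ?thesis using rcos_self[OF x H.subgroup_axioms] coset_mult_one[OF H.subset] by simp
    qed
    then show False using H(2) H.subset by auto
  qed
qed

theorem theorem4p8:
  fixes G :: "('a, 'b) monoid_scheme" and m :: nat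
  assumes "group G" and "finite (carrier G)" and "m > 0"
  shows
    "((\<forall>H. H \<lhd> G \<and> H \<noteq> carrier G \<longrightarrow>
          \<not> comm_group (G Mod H) \<and> order (G Mod H) \<ge> m) \<longrightarrow>
        \<not> (\<exists>d \<rho>. nontrivial_representation G d \<rho> \<and> real d < sqrt (ln (real m)) / 2))
     \<and> ((\<exists>H. H \<lhd> G \<and> H \<noteq> carrier G \<and> comm_group (G Mod H)) \<longrightarrow>
        (\<exists>\<rho>. nontrivial_representation G 1 \<rho>))
     \<and> ((\<exists>H. H \<lhd> G \<and> H \<noteq> carrier G \<and> order (G Mod H) = m) \<longrightarrow>
        (\<exists>d \<rho>. nontrivial_representation G d \<rho> \<and> real d \<le> sqrt (real m)))"
proof (intro conjI impI)
  assume large: "\<forall>H. H \<lhd> G \<and> H \<noteq> carrier G \<longrightarrow> \<not> comm_group (G Mod H) \<and> order (G Mod H) \<ge> m"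
  show "\<not> (\<exists>d \<rho>. nontrivial_representation G d \<rho> \<and> real d < sqrt (ln (real m)) / 2)"
  proof clarify
    fix d \<rho> assume "nontrivial_representation G d \<rho>" and d: "real d < sqrt (ln (real m)) / 2"
    then obtain H where "H \<lhd> G" "H \<noteq> carrier G"
      "comm_group (G Mod H) \<or> order (G Mod H) \<le> 6 ^ (2 * d * d)"
      using comm_quotient_or_small_quotient[OF assms(1,2)] by blast
    then show False using large six_power_lt_of_dim_lt[OF assms(3) d] by (meson leD le_trans)
  qed
next
  assume "\<exists>H. H \<lhd> G \<and> H \<noteq> carrier G \<and> comm_group (G Mod H)"
  then obtain H where H: "H \<lhd> G" "H \<noteq> carrier G" and comm: "comm_group (G Mod H)" by blast
  note Q = normal.factorgroup_is_group[OF H(1)] order_nontrivial_quotient[OF assms(1,2) H]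
  \<comment> \<open>Both converse claims take a non-trivial representation of least dimension of the
    quotient, bound its dimension there and inflate it to \<open>G\<close>.\<close>
  obtain d \<rho> where nt: "nontrivial_representation (G Mod H) d \<rho>"
    and minimal: "\<And>e \<sigma>. e < d \<Longrightarrow> \<not> nontrivial_representation (G Mod H) e \<sigma>"
    using exists_minimal_nontrivial_representation[OF Q(1,3,2)] by blast
  have "d = 1" by (rule minimal_representation_of_comm_group[OF comm Q(3) nt minimal])
  then show "\<exists>\<rho>. nontrivial_representation G 1 \<rho>"
    using nontrivial_representation_inflate[OF H(1) nt] by blast
next
  assume "\<exists>H. H \<lhd> G \<and> H \<noteq> carrier G \<and> order (G Mod H) = m"
  then obtain H where H: "H \<lhd> G" "H \<noteq> carrier G" and m: "order (G Mod H) = m" by blast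
  note Q = normal.factorgroup_is_group[OF H(1)] order_nontrivial_quotient[OF assms(1,2) H]
  obtain d \<rho> where nt: "nontrivial_representation (G Mod H) d \<rho>"
    and minimal: "\<And>e \<sigma>. e < d \<Longrightarrow> \<not> nontrivial_representation (G Mod H) e \<sigma>"
    using exists_minimal_nontrivial_representation[OF Q(1,3,2)] by blast
  have "d * d \<le> m" using minimal_representation_dim_square_le[OF Q(1,3) nt minimal] m by simp
  then have "(real d)\<^sup>2 \<le> real m" by (simp add: power2_eq_square flip: of_nat_mult)
  then have "real d \<le> sqrt (real m)" by (rule real_le_rsqrt)
  then show "\<exists>d \<rho>. nontrivial_representation G d \<rho> \<and> real d \<le> sqrt (real m)"
    using nontrivial_representation_inflate[OF H(1) nt] by blast
qed

end
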